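(* Let $0<\alpha<1$. Then, for $u\in\mathcal{S}(\mathbb{R})$, (i) $k_{-\alpha}u=(-\Delta)^{\alpha/2}u$; (ii) $H_{-\alpha}u=-\frac{1}{2\sin\frac{\pi\alpha}{2}}\big[(D_{\rm right})^\alpha u-(D_{\rm left})^\alpha u\big]$; (iii) $H_{-\alpha}u=H(-\Delta)^{\alpha/2}u$, where $H$ is the Hilbert transform on $\mathbb{R}$.
   Context: For $0<\alpha<1$ and $u\in\mathcal{S}(\mathbb{R})$, define $$k_{-\alpha}u(x)=-\frac1\pi\Gamma(1+\alpha)\sin\tfrac{\pi\alpha}{2}\,\mathrm{P.V.}\int_{\mathbb{R}}\frac{u(t)-u(x)}{|t-x|^{1+\alpha}}\,dt,$$ $$H_{-\alpha}u(x)=\frac1\pi\Gamma(1+\alpha)\cos\tfrac{\pi\alpha}{2}\int_0^\infty\frac{u(x+t)-u(x-t)}{t^{1+\alpha}}\,dt,$$ $$(D_{\rm right})^\alpha u(x)=\frac{1}{\Gamma(-\alpha)}\int_0^\infty\frac{u(x+t)-u(x)}{t^{1+\alpha}}\,dt,\qquad(D_{\rm left})^\alpha u(x)=\frac{1}{\Gamma(-\alpha)}\int_0^\infty\frac{u(x-t)-u(x)}{t^{1+\alpha}}\,dt.$$ For $0<\beta<1$, $(-\Delta)^\beta u=\frac{1}{\Gamma(-\beta)}\int_0^\infty(e^{t\Delta}u-u)\,\frac{dt}{t^{1+\beta}}$, where $\Delta=d^2/dx^2$ and $e^{t\Delta}$ is the classical heat semigroup on $\mathbb{R}$ (Fourier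 multiplier $e^{-t\xi^2}$). The Fourier transform is $\widehat u(\xi)=\frac{1}{(2\pi)^{1/2}}\int_{\mathbb{R}}u(x)e^{-ix\xi}\,dx$. The Hilbert transform is normalized by $\widehat{Hf}(\xi)=i\,\mathrm{sign}(\xi)\widehat f(\xi)$, i.e. $Hf(x)=\frac1\pi\,\mathrm{P.V.}\int_{\mathbb{R}}\frac{f(t)}{t-x}\,dt$. *)

theory Defs
  imports "HOL-Analysis.Analysis"
begin

text \<open>
  Functions on the real line are complex-valued, and all operators act on arbitrary functions
  \<open>real \<Rightarrow> complex\<close>. Since the Bochner integral and \<open>Lim\<close> return an arbitrary value where the
  underlying expression does not converge, every operator comes with a predicate \<open>..._converges\<close>
  saying that the integrals in its formula make sense at a given point.
\<close>

section \<open>Schwartz functions\<close>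

definition vderiv :: "nat \<Rightarrow> (real \<Rightarrow> complex) \<Rightarrow> real \<Rightarrow> complex" where
  "vderiv m = (\<lambda>f x. vector_derivative f (at x)) ^^ m"

definition schwartz :: "(real \<Rightarrow> complex) \<Rightarrow> bool" where
  "schwartz u \<longleftrightarrow>
     (\<forall>m x. vderiv m u differentiable at x) \<and>
     (\<forall>k m. bounded (range (\<lambda>x. x ^ k *\<^sub>R vderiv m u x)))"

section \<open>Principal values\<close>

text \<open>
  The only singularity is at \<open>a\<close>: each truncated integral over \<open>\<bar>t - a\<bar> > \<epsilon>\<close> is required to
  converge absolutely, in particular at infinity.
\<close>

definition pv_converges :: "real \<Rightarrow> (real \<Rightarrow> complex) \<Rightarrow> bool" where
  "pv_converges a f \<longleftrightarrow>
     (\<forall>\<epsilon>>0. set_integrable lborel {t. \<bar>t - a\<bar> > \<epsilon>} f) \<and>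
     (\<exists>L. ((\<lambda>\<epsilon>. LBINT t:{t. \<bar>t - a\<bar> > \<epsilon>}. f t) \<longlongrightarrow> L) (at_right 0))"

definition pv_integral :: "real \<Rightarrow> (real \<Rightarrow> complex) \<Rightarrow> complex" where
  "pv_integral a f = Lim (at_right 0) (\<lambda>\<epsilon>. LBINT t:{t. \<bar>t - a\<bar> > \<epsilon>}. f t)"

section \<open>The operators with subscript \<open>-\<alpha>\<close>\<close>

definition k_minus :: "real \<Rightarrow> (real \<Rightarrow> complex) \<Rightarrow> real \<Rightarrow> complex" where
  "k_minus \<alpha> u x = (- (1 / pi) * Gamma (1 + \<alpha>) * sin (pi * \<alpha> / 2)) *\<^sub>R
     pv_integral x (\<lambda>t. (u t - u x) /\<^sub>R \<bar>t - x\<bar> powr (1 + \<alpha>))"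

definition k_minus_converges :: "real \<Rightarrow> (real \<Rightarrow> complex) \<Rightarrow> real \<Rightarrow> bool" where
  "k_minus_converges \<alpha> u x \<longleftrightarrow>
     pv_converges x (\<lambda>t. (u t - u x) /\<^sub>R \<bar>t - x\<bar> powr (1 + \<alpha>))"

definition H_minus :: "real \<Rightarrow> (real \<Rightarrow> complex) \<Rightarrow> real \<Rightarrow> complex" where
  "H_minus \<alpha> u x = (1 / pi * Gamma (1 + \<alpha>) * cos (pi * \<alpha> / 2)) *\<^sub>R
     (LBINT t:{0<..}. (u (x + t) - u (x - t)) /\<^sub>R t powr (1 + \<alpha>))"

definition H_minus_converges :: "real \<Rightarrow> (real \<Rightarrow> complex) \<Rightarrow> real \<Rightarrow> bool" where
  "H_minus_converges \<alpha> u x \<longleftrightarrow>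
     set_integrable lborel {0<..} (\<lambda>t. (u (x + t) - u (x - t)) /\<^sub>R t powr (1 + \<alpha>))"

section \<open>One-sided fractional derivatives\<close>

definition D_right :: "real \<Rightarrow> (real \<Rightarrow> complex) \<Rightarrow> real \<Rightarrow> complex" where
  "D_right \<alpha> u x = (1 / Gamma (- \<alpha>)) *\<^sub>R
     (LBINT t:{0<..}. (u (x + t) - u x) /\<^sub>R t powr (1 + \<alpha>))"

definition D_right_converges :: "real \<Rightarrow> (real \<Rightarrow> complex) \<Rightarrow> real \<Rightarrow> bool" where
  "D_right_converges \<alpha> u x \<longleftrightarrow>
     set_integrable lborel {0<..} (\<lambda>t. (u (x + t) - u x) /\<^sub>R t powr (1 + \<alpha>))"

definition D_left :: "real \<Rightarrow> (real \<Rightarrow> complex) \<Rightarrow> real \<Rightarrow> complex" where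
  "D_left \<alpha> u x = (1 / Gamma (- \<alpha>)) *\<^sub>R
     (LBINT t:{0<..}. (u (x - t) - u x) /\<^sub>R t powr (1 + \<alpha>))"

definition D_left_converges :: "real \<Rightarrow> (real \<Rightarrow> complex) \<Rightarrow> real \<Rightarrow> bool" where
  "D_left_converges \<alpha> u x \<longleftrightarrow>
     set_integrable lborel {0<..} (\<lambda>t. (u (x - t) - u x) /\<^sub>R t powr (1 + \<alpha>))"

section \<open>Heat semigroup and fractional Laplacian\<close>

definition fourier :: "(real \<Rightarrow> complex) \<Rightarrow> real \<Rightarrow> complex" where
  "fourier u \<xi> = (1 / sqrt (2 * pi)) *\<^sub>R (LBINT x. u x * exp (- (\<i> * of_real (x * \<xi>))))"

text \<open>
  The heat semigroup at time \<open>t\<close> as the Fourier multiplier with symbol \<open>exp (- t \<xi>\<^sup>2)\<close>: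
  multiply the Fourier transform by the symbol, then apply the inverse Fourier transform.
\<close>

definition heat :: "real \<Rightarrow> (real \<Rightarrow> complex) \<Rightarrow> real \<Rightarrow> complex" where
  "heat t u x = (1 / sqrt (2 * pi)) *\<^sub>R
     (LBINT \<xi>. of_real (exp (- (t * \<xi>\<^sup>2))) * fourier u \<xi> * exp (\<i> * of_real (x * \<xi>)))"

definition heat_converges :: "real \<Rightarrow> (real \<Rightarrow> complex) \<Rightarrow> bool" where
  "heat_converges t u \<longleftrightarrow>
     integrable lborel u \<and>
     integrable lborel (\<lambda>\<xi>. of_real (exp (- (t * \<xi>\<^sup>2))) * fourier u \<xi>)"

text \<open>\<open>frac_laplacian \<beta>\<close> is the \<open>\<beta>\<close>-th power of \<open>-\<Delta>\<close>.\<close>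

definition frac_laplacian :: "real \<Rightarrow> (real \<Rightarrow> complex) \<Rightarrow> real \<Rightarrow> complex" where
  "frac_laplacian \<beta> u x = (1 / Gamma (- \<beta>)) *\<^sub>R
     (LBINT t:{0<..}. (heat t u x - u x) /\<^sub>R t powr (1 + \<beta>))"

definition frac_laplacian_converges :: "real \<Rightarrow> (real \<Rightarrow> complex) \<Rightarrow> real \<Rightarrow> bool" where
  "frac_laplacian_converges \<beta> u x \<longleftrightarrow>
     (\<forall>t>0. heat_converges t u) \<and>
     set_integrable lborel {0<..} (\<lambda>t. (heat t u x - u x) /\<^sub>R t powr (1 + \<beta>))"

section \<open>Hilbert transform\<close>

text \<open>
  The kernel is \<open>1 / (t - x)\<close>, corresponding to the multiplier \<open>\<i> sgn \<xi>\<close>; much of the literature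
  uses the opposite sign.
\<close>

definition hilbert :: "(real \<Rightarrow> complex) \<Rightarrow> real \<Rightarrow> complex" where
  "hilbert f x = (1 / pi) *\<^sub>R pv_integral x (\<lambda>t. f t /\<^sub>R (t - x))"

definition hilbert_converges :: "(real \<Rightarrow> complex) \<Rightarrow> real \<Rightarrow> bool" where
  "hilbert_converges f x \<longleftrightarrow> pv_converges x (\<lambda>t. f t /\<^sub>R (t - x))"

end

(*
Write A_s u(x) = u(x+s) + u(x-s) - 2 u(x) and L u(x) = int_0^oo A_s u(x) s^(-1-alpha) ds. Everything
is done on the real side, without Fourier inversion.

(i) k_{-alpha} u is a multiple of L u. Since the heat semigroup is convolution with a Gaussian G_t,
e^{t Delta} u - u = int_0^oo G_t(s) A_s u ds; integrating against t^(-1-alpha/2) first in t turns G_t(s)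
into a multiple of s^(-1-alpha). The constants agree by the reflection and duplication formulas for Gamma.

(ii) is linearity together with the reflection formula.

(iii) L u is integrable and Lipschitz, so its Hilbert transform is the limit as y -> 0 of its integrals
against the conjugate Poisson kernel Q_y(t) = Re (1/(t+iy)). By Fubini L moves from u onto Q_y, and L Q_y is
explicit: int_0^oo (1/(z+s) - 1/z) s^(-1-alpha) ds = - Gamma(alpha) Gamma(1-alpha) z^(-1-alpha) off the
negative real axis, by scaling for z > 0 and by analytic continuation in general. The kernel L Q_y is odd,
dominated by |t|^(-1-alpha), and converges to a multiple of t^(-1-alpha) for t > 0.
*)

theory Submission
  imports Defs "HOL-Probability.Sinc_Integral" "HOL-Probability.Characteristic_Functions" "HOL-Complex_Analysis.Conformal_Mappings"
begin

text \<open>The exchange of L with the kernel shapes (iii). The kernel 1/t is neither bounded nor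
  Lipschitz, so it cannot be paired with L under Fubini; for fixed y > 0 the kernel Q_y is both, but
  with constants that blow up as y -> 0. Control of L Q_y uniform in y is therefore read off from
  its closed form. The resulting majorant |t|^(-1-alpha) is still not integrable at 0: oddness pairs
  the kernel with u(x+t) - u(x-t), which supplies the missing factor t.

  Since alpha < 1, first-order increments suffice throughout: they are O(min(1,|s|)) for a Schwartz
  function, and min(1,s) s^(-1-alpha) is integrable on the half-line.

  The cosine in (iii) comes from a branch of the power. Passing from z to -z in the upper half-plane
  multiplies z^(-1-alpha) by -e^(i pi alpha), so a factor 1 + e^(i pi alpha) appears, whose real
  part is 2 cos^2(pi alpha/2); against Gamma(alpha) Gamma(1-alpha) = pi / sin(pi alpha) this leaves
  pi cot(pi alpha/2), and the sine in the constant of k_{-alpha} turns the cotangent into the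
  cosine.\<close>

section \<open>Limits under the integral, translation, reflection and principal values\<close>

lemma integral_dominated_convergence_within:
  fixes f :: "'b::first_countable_topology \<Rightarrow> 'a \<Rightarrow> 'c::{banach, second_countable_topology}"
  assumes "g \<in> borel_measurable M" "\<And>t. t \<in> S - {z} \<Longrightarrow> f t \<in> borel_measurable M" "integrable M w"
    and lim: "AE x in M. ((\<lambda>t. f t x) \<longlongrightarrow> g x) (at z within S)"
    and bound: "\<And>t x. t \<in> S - {z} \<Longrightarrow> norm (f t x) \<le> w x"
  shows "((\<lambda>t. integral\<^sup>L M (f t)) \<longlongrightarrow> integral\<^sup>L M g) (at z within S)"
  unfolding tendsto_at_iff_sequentially
proof (intro allI impI)
  fix X assume X: "\<forall>i. X i \<in> S - {z}" "X \<longlonglongrightarrow> z"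
  have "(\<lambda>i. integral\<^sup>L M (f (X i))) \<longlonglongrightarrow> integral\<^sup>L M g"
  proof (rule integral_dominated_convergence[where w=w])
    show "AE x in M. (\<lambda>i. f (X i) x) \<longlonglongrightarrow> g x"
      using lim
    proof eventually_elim
      fix x assume "((\<lambda>t. f t x) \<longlongrightarrow> g x) (at z within S)"
      then show "(\<lambda>i. f (X i) x) \<longlonglongrightarrow> g x"
        using X unfolding tendsto_at_iff_sequentially by (auto simp: o_def)
    qed
  qed (use assms X in auto)
  then show "((\<lambda>t. integral\<^sup>L M (f t)) \<circ> X) \<longlonglongrightarrow> integral\<^sup>L M g"
    by (simp add: o_def)
qed

lemma integral_translation:
  fixes f :: "real \<Rightarrow> 'a::{banach, second_countable_topology}"
  shows "(LBINT t. f (t + s)) = (LBINT t. f t)" "(LBINT t. f (t - s)) = (LBINT t. f t)"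
    "(LBINT t. f (s + t)) = (LBINT t. f t)"
  using lborel_integral_real_affine[of 1 f s] lborel_integral_real_affine[of 1 f "-s"]
  by (simp_all add: add.commute)

lemma integrable_translation:
  fixes f :: "real \<Rightarrow> 'a::{banach, second_countable_topology}"
  assumes "integrable lborel f"
  shows "integrable lborel (\<lambda>t. f (t + s))" "integrable lborel (\<lambda>t. f (t - s))"
    "integrable lborel (\<lambda>t. f (s + t))"
  using lborel_integrable_real_affine[OF assms, of 1 s] lborel_integrable_real_affine[OF assms, of 1 "-s"]
  by (simp_all add: add.commute)

lemma integral_reflect:
  fixes f :: "real \<Rightarrow> 'a::{banach, second_countable_topology}"
  shows "(LBINT t. f (- t)) = (LBINT t. f t)"
  using lborel_integral_real_affine[of "-1" f 0] by simp

lemma integrable_reflect: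
  fixes f :: "real \<Rightarrow> 'a::{banach, second_countable_topology}"
  shows "integrable lborel f \<Longrightarrow> integrable lborel (\<lambda>t. f (- t))"
  using lborel_integrable_real_affine[of f "-1" 0] by simp

text \<open>The reflection \<open>t \<mapsto> - t\<close> folds the negative half onto the positive
  one. The cancellation behind every principal value below then takes place inside a single
  integrand.\<close>

lemma set_integral_symmetric_pair:
  fixes h :: "real \<Rightarrow> 'a::{banach, second_countable_topology}"
  assumes "0 \<le> e" "set_integrable lborel {t. \<bar>t\<bar> > e} h"
  shows "set_integrable lborel {e<..} (\<lambda>s. h s + h (- s))"
    and "(LBINT t:{t. \<bar>t\<bar> > e}. h t) = (LBINT s:{e<..}. h s + h (- s))"
proof -
  have i: "set_integrable lborel {e<..} h"
    by (rule set_integrable_subset[OF assms(2)]) auto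
  have i2: "set_integrable lborel {..<-e} h"
    by (rule set_integrable_subset[OF assms(2)]) auto
  have eq: "indicator {..<-e} (- x) *\<^sub>R h (- x) = indicator {e<..} x *\<^sub>R h (- x)" for x
    by (auto simp: indicator_def)
  have i3: "set_integrable lborel {e<..} (\<lambda>s. h (- s))"
    using integrable_reflect[OF i2[unfolded set_integrable_def]]
    unfolding eq by (simp add: set_integrable_def)
  show "set_integrable lborel {e<..} (\<lambda>s. h s + h (- s))"
    by (intro set_integral_add i i3)
  have "{t. \<bar>t\<bar> > e} = {e<..} \<union> {..<-e}" by (auto simp: abs_real_def)
  then have "(LBINT t:{t. \<bar>t\<bar> > e}. h t) = (LBINT t:{e<..} \<union> {..<-e}. h t)" by simp
  also have "\<dots> = (LBINT t:{e<..}. h t) + (LBINT t:{..<-e}. h t)"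
    by (rule set_integral_Un) (use i i2 assms in auto)
  also have "(LBINT t:{..<-e}. h t) = (LBINT t:{e<..}. h (- t))"
    unfolding set_lebesgue_integral_def
    by (subst integral_reflect[symmetric]) (simp only: eq)
  also have "(LBINT t:{e<..}. h t) + (LBINT t:{e<..}. h (- t)) = (LBINT s:{e<..}. h s + h (- s))"
    by (rule set_integral_add(2)[symmetric]) (use i i3 in auto)
  finally show "(LBINT t:{t. \<bar>t\<bar> > e}. h t) = (LBINT s:{e<..}. h s + h (- s))" .
qed

lemma integral_symmetric_pair:
  fixes h :: "real \<Rightarrow> 'a::{banach, second_countable_topology}"
  assumes "integrable lborel h"
  shows "set_integrable lborel {0<..} (\<lambda>s. h s + h (- s))"
    and "(LBINT t. h t) = (LBINT s:{0<..}. h s + h (- s))"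
proof -
  have i: "set_integrable lborel {t. \<bar>t\<bar> > 0} h"
    unfolding set_integrable_def by (rule integrable_mult_indicator) (use assms in auto)
  show "set_integrable lborel {0<..} (\<lambda>s. h s + h (- s))"
    by (rule set_integral_symmetric_pair(1)[OF _ i]) simp
  have "(LBINT t. h t) = (LBINT t:{t. \<bar>t\<bar> > 0}. h t)"
    unfolding set_lebesgue_integral_def
    by (rule integral_discrete_difference[of "{0}"]) auto
  also have "\<dots> = (LBINT s:{0<..}. h s + h (- s))"
    by (rule set_integral_symmetric_pair(2)[OF _ i]) simp
  finally show "(LBINT t. h t) = (LBINT s:{0<..}. h s + h (- s))" .
qed

text \<open>After folding, truncation at e is merely restriction to \<open>{e<..}\<close>. If the
  folded integrand is integrable up to 0, dominated convergence removes the truncation, so the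
  principal value becomes an absolutely convergent integral.\<close>

lemma pv_symmetric_pair:
  assumes g: "\<And>e. e > 0 \<Longrightarrow> set_integrable lborel {t. \<bar>t - a\<bar> > e} g"
    and h: "set_integrable lborel {0<..} (\<lambda>t. g (a + t) + g (a - t))"
  shows "pv_converges a g" and "pv_integral a g = (LBINT t:{0<..}. g (a + t) + g (a - t))"
proof -
  have *: "(LBINT t:{t. \<bar>t - a\<bar> > e}. g t) = (LBINT t:{e<..}. g (a + t) + g (a - t))"
    if "e > 0" for e
  proof -
    have i: "set_integrable lborel {t. \<bar>t\<bar> > e} (\<lambda>t. g (a + t))"
      using integrable_translation(3)[OF g[OF that, unfolded set_integrable_def], of a]
      by (simp add: set_integrable_def indicator_def)
    have "(LBINT t:{t. \<bar>t - a\<bar> > e}. g t) = (LBINT t:{t. \<bar>t\<bar> > e}. g (a + t))"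
      unfolding set_lebesgue_integral_def
      by (subst integral_translation(3)[of _ a, symmetric]) (simp add: indicator_def)
    also have "\<dots> = (LBINT s:{e<..}. g (a + s) + g (a + - s))"
      by (rule set_integral_symmetric_pair(2)) (use i that in auto)
    finally show ?thesis by simp
  qed
  have "((\<lambda>e. LBINT t:{e<..}. g (a + t) + g (a - t)) \<longlongrightarrow> (LBINT t:{0<..}. g (a + t) + g (a - t)))
      (at_right 0)"
    unfolding set_lebesgue_integral_def
  proof (rule integral_dominated_convergence_within)
    show "integrable lborel (\<lambda>t. norm (indicator {0<..} t *\<^sub>R (g (a + t) + g (a - t))))"
      using h unfolding set_integrable_def by (rule integrable_norm)
    show "(\<lambda>t. indicator {0<..} t *\<^sub>R (g (a + t) + g (a - t))) \<in> borel_measurable lborel"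
      using h unfolding set_integrable_def by (rule borel_measurable_integrable)
    show "(\<lambda>t. indicator {e<..} t *\<^sub>R (g (a + t) + g (a - t))) \<in> borel_measurable lborel"
      if "e \<in> {0<..} - {0}" for e
      using set_integrable_subset[OF h, of "{e<..}"] that
      unfolding set_integrable_def by (intro borel_measurable_integrable) auto
    show "AE t in lborel. ((\<lambda>e. indicator {e<..} t *\<^sub>R (g (a + t) + g (a - t))) \<longlongrightarrow>
        indicator {0<..} t *\<^sub>R (g (a + t) + g (a - t))) (at_right 0)"
    proof (rule AE_I2)
      fix t :: real
      show "((\<lambda>e. indicator {e<..} t *\<^sub>R (g (a + t) + g (a - t))) \<longlongrightarrow>
        indicator {0<..} t *\<^sub>R (g (a + t) + g (a - t))) (at_right 0)"
      \<comment> \<open>The integrand is eventually constant in e: for t > 0 the two indicators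
        agree once e < t, and for t <= 0 both vanish for every e > 0.\<close>
      proof (rule tendsto_eventually)
        show "\<forall>\<^sub>F e in at_right 0. indicator {e<..} t *\<^sub>R (g (a + t) + g (a - t)) =
          indicator {0<..} t *\<^sub>R (g (a + t) + g (a - t))"
          by (rule eventually_at_rightI[of 0 "if t > 0 then t else 1"])
             (auto simp: indicator_def split: if_splits)
      qed
    qed
  qed (auto simp: indicator_def)
  then have lim: "((\<lambda>e. LBINT t:{t. \<bar>t - a\<bar> > e}. g t) \<longlongrightarrow> (LBINT t:{0<..}. g (a + t) + g (a - t)))
      (at_right 0)"
    by (rule Lim_transform_eventually) (auto simp: eventually_at_right_less * intro!: eventually_at_rightI[of 0 1])
  show "pv_converges a g"
    unfolding pv_converges_def using g lim by blast
  show "pv_integral a g = (LBINT t:{0<..}. g (a + t) + g (a - t))"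
    unfolding pv_integral_def by (rule tendsto_Lim[OF _ lim]) simp
qed

section \<open>The integrable weight that dominates all singular integrals\<close>

text \<open>The numerator \<open>min 1 s\<close> is the size of an increment of a bounded Lipschitz
  function over a step s. The indicator is part of the weight so that it can serve as a majorant on
  the whole line.\<close>

definition truncated_weight :: "real \<Rightarrow> real \<Rightarrow> real" where
  "truncated_weight a s = indicator {0<..} s * (min 1 s / s powr (1 + a))"

lemma truncated_weight_nonneg: "0 \<le> truncated_weight a s"
  by (auto simp: truncated_weight_def indicator_def)

lemma integrable_truncated_weight:
  assumes "0 < a" "a < 1"
  shows "integrable lborel (truncated_weight a)"
proof -
  have 1: "(\<lambda>s. s powr (- a)) absolutely_integrable_on {0..1}"
    using integrable_on_powr_from_0[of "-a" 1] assms
    by (subst absolutely_integrable_on_iff_nonneg) auto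
  have "((\<lambda>s. s powr (- 1 - a)) has_integral - (1 powr (- 1 - a + 1)) / (- 1 - a + 1)) {1..}"
    by (rule has_integral_powr_to_inf) (use assms in auto)
  then have 2: "(\<lambda>s. s powr (- 1 - a)) absolutely_integrable_on {1..}"
    by (subst absolutely_integrable_on_iff_nonneg) (auto simp: integrable_on_def)
  \<comment> \<open>The integrals just found are with respect to the completed measure; Borel
    measurability of the integrands brings them back to \<open>lborel\<close>.\<close>
  have 3: "integrable lborel (\<lambda>s. indicator {0..1} s *\<^sub>R s powr (- a))"
    using 1 by (subst (asm) set_integrable_def, subst (asm) integrable_completion) auto
  have 4: "integrable lborel (\<lambda>s. indicator {1..} s *\<^sub>R s powr (- 1 - a))"
    using 2 by (subst (asm) set_integrable_def, subst (asm) integrable_completion) auto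
  show ?thesis
  proof (rule Bochner_Integration.integrable_bound[OF Bochner_Integration.integrable_add[OF 3 4]])
    show "truncated_weight a \<in> borel_measurable lborel"
      unfolding truncated_weight_def[abs_def] by measurable
    have "norm (truncated_weight a s) \<le>
        norm (indicator {0..1} s *\<^sub>R s powr - a + indicator {1..} s *\<^sub>R s powr (- 1 - a))" for s
    proof -
      consider "s \<le> 0" | "0 < s" "s < 1" | "s \<ge> 1" by linarith
      then show ?thesis
      proof cases
        case 2
        then have "s / s powr (1 + a) = s powr (- a)"
          by (simp add: powr_add powr_minus field_simps)
        with 2 show ?thesis by (simp add: truncated_weight_def)
      next
        case 3
        then have "1 / s powr (1 + a) = s powr (- 1 - a)"
          using powr_minus[of s "1 + a"] by (simp add: field_simps)
        with 3 show ?thesis by (simp add: truncated_weight_def indicator_def)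
      qed (auto simp: truncated_weight_def)
    qed
    then show "AE s in lborel. norm (truncated_weight a s) \<le>
        norm (indicator {0..1} s *\<^sub>R s powr - a + indicator {1..} s *\<^sub>R s powr (- 1 - a))" by simp
  qed
qed


section \<open>Gamma integrals and the Stieltjes transform of a power\<close>

lemma has_bochner_integral_Gamma_scaled:
  fixes b p :: real
  assumes "b > 0" "p > 0"
  shows "has_bochner_integral lborel (\<lambda>t. indicator {0<..} t * (t powr (b - 1) * exp (- (p * t))))
    (Gamma b / p powr b)"
proof -
  let ?g = "\<lambda>t::real. t powr (b - 1) / exp t"
  have 0: "(?g has_integral Gamma b) {0..}"
    by (rule Gamma_integral_real) fact
  have 1: "?g absolutely_integrable_on {0..}"
    using 0 by (subst absolutely_integrable_on_iff_nonneg) (auto simp: integrable_on_def)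
  then have 2: "set_integrable lborel {0..} ?g"
    by (subst (asm) set_integrable_def, subst (asm) integrable_completion)
       (auto simp: set_integrable_def)
  have "(LBINT t:{0..}. ?g t) = Gamma b"
    using set_borel_integral_eq_integral(2)[OF 2] 0 by (simp add: integral_unique)
  with 2 have 3: "has_bochner_integral lborel (\<lambda>t. indicator {0..} t *\<^sub>R ?g t) (Gamma b)"
    by (simp add: set_integrable_def set_lebesgue_integral_def has_bochner_integral_iff)
  have 4: "has_bochner_integral lborel (\<lambda>t. indicator {0..} (p * t) * (?g (p * t))) (Gamma b / p)"
    using 3 lborel_has_bochner_integral_real_affine_iff[of p "\<lambda>t. indicator {0..} t *\<^sub>R ?g t" "Gamma b" 0] assms
    by (simp add: field_simps)
  \<comment> \<open>Rescaling by p produces \<open>p powr (b - 1)\<close> from the power of t; the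
    factor \<open>p powr (1 - b)\<close> cancels it.\<close>
  have 5: "has_bochner_integral lborel (\<lambda>t. p powr (1 - b) * (indicator {0..} (p * t) * ?g (p * t)))
      (p powr (1 - b) * (Gamma b / p))"
    using has_bochner_integral_mult_right[OF 4] by auto
  \<comment> \<open>The passage from \<open>{0..}\<close> to \<open>{0<..}\<close> is a pointwise
    equality: at t = 0 the left side vanishes too, because
    \<open>0 powr (b - 1) = 0\<close>.\<close>
  have "p powr (1 - b) * (indicator {0..} (p * t) * ?g (p * t)) =
      indicator {0<..} t * (t powr (b - 1) * exp (- (p * t)))" for t
  proof -
    consider "t < 0" | "t = 0" | "t > 0" by linarith
    then show ?thesis
    proof cases
      case 3
      have *: "p powr (1 - b) * p powr (b - 1) = 1"
        using assms by (simp add: powr_add[symmetric])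
      have "p powr (1 - b) * (indicator {0..} (p * t) * ?g (p * t)) =
          (p powr (1 - b) * p powr (b - 1)) * (indicator {0<..} t * (t powr (b - 1) * exp (- (p * t))))"
        using 3 assms by (simp add: indicator_def powr_mult exp_minus divide_inverse)
      then show ?thesis unfolding * by simp
    qed (use assms in \<open>auto simp: indicator_def zero_le_mult_iff\<close>)
  qed
  moreover have "p powr (1 - b) * (Gamma b / p) = Gamma b / p powr b"
    using assms by (simp add: powr_diff)
  ultimately show ?thesis using 5 by (simp cong: has_bochner_integral_cong)
qed

lemma truncated_weight_eq:
  assumes "s > 0"
  shows "truncated_weight a s = s powr (- a) * min 1 (1 / s)"
proof -
  have "s powr (1 + a) = s * s powr a" using assms by (simp add: powr_add)
  then show ?thesis using assms
    by (auto simp: truncated_weight_def min_def powr_minus field_simps)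
qed

text \<open>For bounded s the distance from z to -s has a positive minimum by compactness; for large
  s the triangle inequality gives linear growth. The linear growth is what makes the Stieltjes
  integrand decay like s^(-1-a).\<close>

lemma slit_plane_lower_bound:
  assumes "z \<notin> \<real>\<^sub>\<le>\<^sub>0"
  obtains c where "c > 0" "\<And>s. s \<ge> 0 \<Longrightarrow> c * (1 + s) \<le> cmod (z + of_real s)"
proof -
  \<comment> \<open>The threshold beyond which \<open>s - cmod z\<close> is at least (1 + s) /
    2.\<close>
  define R where "R = 2 * cmod z + 1"
  have "\<exists>x\<in>{0..R}. \<forall>y\<in>{0..R}. cmod (z + of_real x) \<le> cmod (z + of_real y)"
    by (rule continuous_attains_inf) (auto intro!: continuous_intros simp: R_def)
  then obtain x where x: "x \<in> {0..R}" "\<And>y. y \<in> {0..R} \<Longrightarrow> cmod (z + of_real x) \<le> cmod (z + of_real y)"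
    by blast
  define m where "m = cmod (z + of_real x)"
  have "z + of_real x \<noteq> 0"
  proof
    assume "z + of_real x = 0"
    then have "z = of_real (- x)" by (simp add: eq_neg_iff_add_eq_0)
    with x assms show False by (auto simp: complex_nonpos_Reals_iff)
  qed
  then have m: "m > 0" by (simp add: m_def)
  have R: "R \<ge> 1" by (simp add: R_def)
  show ?thesis
  proof (rule that[of "min (1/2) (m / (1 + R))"])
    show "0 < min (1 / 2) (m / (1 + R))" using m R by simp
    fix s :: real assume s: "s \<ge> 0"
    show "min (1/2) (m / (1 + R)) * (1 + s) \<le> cmod (z + of_real s)"
    proof (cases "s \<le> R")
      case True
      have "min (1/2) (m / (1 + R)) * (1 + s) \<le> m / (1 + R) * (1 + R)"
        by (rule mult_mono) (use True s R m in auto)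
      also have "\<dots> = m" using R by simp
      also have "m \<le> cmod (z + of_real s)" using x(2)[of s] True s by (simp add: m_def)
      finally show ?thesis .
    next
      case False
      have "min (1/2) (m / (1 + R)) * (1 + s) \<le> 1/2 * (1 + s)"
        by (rule mult_right_mono[OF min.cobounded1]) (use s in auto)
      also have "\<dots> \<le> s - cmod z" using False by (simp add: R_def)
      also have "\<dots> \<le> cmod (z + of_real s)"
        using norm_diff_ineq[of "of_real s" z] s by (simp add: add.commute)
      finally show ?thesis .
    qed
  qed
qed

text \<open>The Stieltjes transform of \<open>s powr (- a)\<close>, which will turn out to be a
  constant multiple of z^(-a) on the plane slit along the negative axis.\<close>

definition stieltjes_power :: "real \<Rightarrow> complex \<Rightarrow> complex" where
  "stieltjes_power a z = (LBINT s:{0<..}. of_real (s powr (- a)) / (z + of_real s))"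

text \<open>The lower bound is a hypothesis, rather than membership of z in the slit plane, so that
  one constant c can serve a whole disc of points when difference quotients are dominated.\<close>

lemma stieltjes_integrand_bound:
  assumes "c > 0" "\<And>s. s \<ge> 0 \<Longrightarrow> c * (1 + s) \<le> cmod (z + of_real s)"
  shows "cmod (indicator {0<..} s *\<^sub>R (of_real (s powr (- a)) / (z + of_real s))) \<le>
    1 / c * truncated_weight a s"
proof (cases "s > 0")
  case True
  have "0 < c * (1 + s)" using assms(1) True by simp
  with assms(2)[of s] True have "1 / cmod (z + of_real s) \<le> 1 / (c * (1 + s))"
    by (intro divide_left_mono mult_pos_pos[of "cmod (z + of_real s)"]) linarith+
  also have "\<dots> = 1 / c * (1 / (1 + s))" by simp
  also have "\<dots> \<le> 1 / c * min 1 (1 / s)"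
    using True assms(1) by (intro mult_left_mono min.boundedI divide_left_mono) auto
  finally have "s powr (- a) * (1 / cmod (z + of_real s)) \<le> s powr (- a) * (1 / c * min 1 (1 / s))"
    by (rule mult_left_mono) simp
  then show ?thesis
    using True truncated_weight_eq[OF True, of a] by (simp add: norm_divide mult_ac)
qed (simp add: truncated_weight_def)

lemma stieltjes_set_integrable:
  fixes z :: complex
  assumes "0 < a" "a < 1" "z \<notin> \<real>\<^sub>\<le>\<^sub>0"
  shows "set_integrable lborel {0<..} (\<lambda>s. of_real (s powr (- a)) / (z + of_real s))"
proof -
  obtain c where c: "c > 0" "\<And>s. s \<ge> 0 \<Longrightarrow> c * (1 + s) \<le> cmod (z + of_real s)"
    using slit_plane_lower_bound[OF assms(3)] by blast
  show ?thesis
    unfolding set_integrable_def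
  proof (rule Bochner_Integration.integrable_bound)
    show "integrable lborel (\<lambda>s. 1 / c * truncated_weight a s)"
      using integrable_truncated_weight[OF assms(1,2)] by simp
    show "AE s in lborel. norm (indicator {0<..} s *\<^sub>R (of_real (s powr (- a)) / (z + of_real s)))
        \<le> norm (1 / c * truncated_weight a s)"
      using stieltjes_integrand_bound[OF c] c(1)
      by (intro AE_I2) (smt (verit, best) real_norm_def norm_ge_zero)
  qed measurable
qed

text \<open>Differentiation under the integral: the difference quotient of 1/(z+s) is exactly
  -1/((z+s)(w+s)), so only dominated convergence as w tends to z remains.\<close>

lemma stieltjes_power_holomorphic:
  assumes "0 < a" "a < 1"
  shows "stieltjes_power a holomorphic_on - \<real>\<^sub>\<le>\<^sub>0"
proof (rule holomorphic_onI)
  fix z :: complex assume "z \<in> - \<real>\<^sub>\<le>\<^sub>0"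
  then have z: "z \<notin> \<real>\<^sub>\<le>\<^sub>0" by simp
  obtain c where c: "c > 0" "\<And>s. s \<ge> 0 \<Longrightarrow> c * (1 + s) \<le> cmod (z + of_real s)"
    using slit_plane_lower_bound[OF z] by blast
  \<comment> \<open>Moving z by less than c/2 costs at most c/2, hence at most half of the lower
    bound c (1 + s).\<close>
  have cw: "c / 2 * (1 + s) \<le> cmod (w + of_real s)" if "w \<in> ball z (c / 2)" "s \<ge> 0" for w s
  proof -
    have "cmod (z + of_real s) \<le> cmod (w + of_real s) + cmod (z - w)"
      using norm_triangle_ineq[of "w + of_real s" "z - w"] by (simp add: add.commute)
    moreover have "cmod (z - w) < c / 2" using that by (simp add: dist_norm)
    moreover have "c * (1 + s) \<le> cmod (z + of_real s)" by (rule c) fact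
    moreover have "c / 2 \<le> c / 2 * (1 + s)" using c(1) that by simp
    ultimately show ?thesis by (simp add: field_simps)
  qed
  have slit: "w \<notin> \<real>\<^sub>\<le>\<^sub>0" if "w \<in> ball z (c / 2)" for w
  proof
    assume "w \<in> \<real>\<^sub>\<le>\<^sub>0"
    then obtain r where r: "w = of_real r" "r \<le> 0" by (auto elim!: nonpos_Reals_cases)
    with cw[OF that, of "- r"] c(1) show False
      by (simp add: mult_le_0_iff)
  qed
  let ?f = "\<lambda>w s. indicator {0<..} s *\<^sub>R (- (of_real (s powr (- a)) / ((z + of_real s) * (w + of_real s))))"
  have lim: "((\<lambda>w. LBINT s. ?f w s) \<longlongrightarrow> (LBINT s. ?f z s)) (at z within ball z (c / 2))"
  proof (rule integral_dominated_convergence_within)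
    show "integrable lborel (\<lambda>s. 2 / (c * c) * truncated_weight a s)"
      using integrable_truncated_weight[OF assms(1,2)] by simp
    show "AE s in lborel. ((\<lambda>w. ?f w s) \<longlongrightarrow> ?f z s) (at z within ball z (c / 2))"
    proof (rule AE_I2)
      fix s
      show "((\<lambda>w. ?f w s) \<longlongrightarrow> ?f z s) (at z within ball z (c / 2))"
      proof (cases "s > 0")
        case True
        then have "z + of_real s \<noteq> 0" using c(2)[of s] c(1)
          by (smt (verit) mult_pos_pos norm_zero)
        then show ?thesis by (intro tendsto_intros) auto
      qed simp
    qed
    fix w s assume "w \<in> ball z (c / 2) - {z}"
    then have w: "w \<in> ball z (c / 2)" by simp
    have b: "cmod (indicator {0<..} s *\<^sub>R (of_real (s powr (- a)) / (w + of_real s))) \<le>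
      1 / (c / 2) * truncated_weight a s"
      by (rule stieltjes_integrand_bound) (use c(1) cw[OF w] in auto)
    show "norm (?f w s) \<le> 2 / (c * c) * truncated_weight a s"
    proof (cases "s > 0")
      case True
      have "c \<le> cmod (z + of_real s)"
        using c(2)[of s] True c(1) by (smt (verit) mult_le_cancel_left1)
      then have "1 / cmod (z + of_real s) \<le> 1 / c"
        using c(1) by (intro divide_left_mono mult_pos_pos) linarith+
      moreover have "norm (?f w s) = 1 / cmod (z + of_real s) *
          cmod (indicator {0<..} s *\<^sub>R (of_real (s powr (- a)) / (w + of_real s)))"
        by (simp add: norm_divide norm_mult)
      moreover have "\<dots> \<le> 1 / c * (1 / (c / 2) * truncated_weight a s)"
        using c(1) b calculation(1) by (intro mult_mono) auto
      ultimately show ?thesis by simp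
    qed (simp add: truncated_weight_def)
  qed measurable
  have quot: "(LBINT s. ?f w s) = (stieltjes_power a w - stieltjes_power a z) / (w - z)"
    if "w \<in> ball z (c / 2)" "w \<noteq> z" for w
  proof -
    have "stieltjes_power a w - stieltjes_power a z =
        (LBINT s. indicator {0<..} s *\<^sub>R (of_real (s powr (- a)) / (w + of_real s)) -
          indicator {0<..} s *\<^sub>R (of_real (s powr (- a)) / (z + of_real s)))"
      unfolding stieltjes_power_def set_lebesgue_integral_def
      by (rule Bochner_Integration.integral_diff[symmetric])
         (use stieltjes_set_integrable[OF assms slit[OF that(1)]] stieltjes_set_integrable[OF assms z]
           in \<open>auto simp: set_integrable_def\<close>)
    also have "\<dots> = (LBINT s. (w - z) * ?f w s)"
    proof (rule Bochner_Integration.integral_cong[OF refl])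
      fix s :: real
      show "indicator {0<..} s *\<^sub>R (of_real (s powr (- a)) / (w + of_real s)) -
          indicator {0<..} s *\<^sub>R (of_real (s powr (- a)) / (z + of_real s)) = (w - z) * ?f w s"
      proof (cases "s > 0")
        case True
        have "z + of_real s \<noteq> 0" "w + of_real s \<noteq> 0"
          using c(2)[of s] cw[OF that(1), of s] c(1) True
          by (smt (verit) mult_pos_pos norm_zero half_gt_zero)+
        moreover have "A / y - A / x = (y - x) * (- (A / (x * y)))"
          if "x \<noteq> 0" "y \<noteq> 0" for A x y :: complex
          using that by (simp add: field_simps)
        ultimately show ?thesis using True by simp
      qed simp
    qed
    also have "\<dots> = (w - z) * (LBINT s. ?f w s)"
      by (rule integral_mult_right_zero)
    finally show ?thesis using that(2) by simp
  qed
  have "((\<lambda>w. (stieltjes_power a w - stieltjes_power a z) / (w - z)) \<longlongrightarrow> (LBINT s. ?f z s))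
      (at z within ball z (c / 2))"
    by (rule Lim_transform_eventually[OF lim])
       (use quot in \<open>auto simp: eventually_at intro!: exI[of _ 1]\<close>)
  then have "(stieltjes_power a has_field_derivative (LBINT s. ?f z s)) (at z within ball z (c / 2))"
    by (simp add: has_field_derivative_iff)
  then have "(stieltjes_power a has_field_derivative (LBINT s. ?f z s)) (at z)"
    using at_within_open[of z "ball z (c / 2)"] c(1) by simp
  then show "stieltjes_power a field_differentiable at z within - \<real>\<^sub>\<le>\<^sub>0"
    using field_differentiable_at_within field_differentiable_def by blast
qed


text \<open>Write 1/(1+s) as the integral of e^(-(1+s) r) over r > 0 and exchange the integrals.
  Integrating in s first yields Gamma(1-a) r^(a-1) e^(-r), whose integral in r is Gamma(1-a)
  Gamma(a).\<close>

lemma stieltjes_power_one: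
  assumes "0 < a" "a < 1"
  shows "stieltjes_power a 1 = of_real (Gamma a * Gamma (1 - a))"
proof -
  \<comment> \<open>The factor \<open>r powr (1 - 1)\<close> equals 1 for r > 0; it puts the
    integral in r into the form of the scaled Gamma integral with b = 1.\<close>
  define f :: "real \<Rightarrow> real \<Rightarrow> real" where
    "f = (\<lambda>s r. (indicator {0<..} s * s powr (- a)) * (indicator {0<..} r * (r powr (1 - 1) * exp (- ((1 + s) * r)))))"
  have fin: "has_bochner_integral lborel (f s) (indicator {0<..} s * (s powr (- a) / (1 + s)))" for s
  proof (cases "s > 0")
    case True
    show ?thesis
      using has_bochner_integral_mult_right[OF has_bochner_integral_Gamma_scaled[of 1 "1 + s"],
          of "indicator {0<..} s * s powr (- a)"] True
      by (simp add: f_def)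
  qed (simp add: f_def has_bochner_integral_zero)
  have fout: "has_bochner_integral lborel (\<lambda>s. f s r)
      (Gamma (1 - a) * (indicator {0<..} r * (r powr (a - 1) * exp (- (1 * r)))))" for r
  proof (cases "r > 0")
    case True
    have "has_bochner_integral lborel
       (\<lambda>s. exp (- r) * (indicator {0<..} s * (s powr ((1 - a) - 1) * exp (- (r * s)))))
       (exp (- r) * (Gamma (1 - a) / r powr (1 - a)))"
      using has_bochner_integral_mult_right[OF has_bochner_integral_Gamma_scaled[of "1 - a" r], of "exp (- r)"]
        True assms by auto
    moreover have "exp (- r) * (indicator {0<..} s * (s powr ((1 - a) - 1) * exp (- (r * s)))) = f s r" for s
      using True by (simp add: f_def ring_distribs exp_add mult_ac flip: exp_add)
    moreover have "exp (- r) * (Gamma (1 - a) / r powr (1 - a)) =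
        Gamma (1 - a) * (indicator {0<..} r * (r powr (a - 1) * exp (- (1 * r))))"
      using True powr_minus[of r "1 - a"] by (simp add: field_simps)
    ultimately show ?thesis by simp
  qed (simp add: f_def has_bochner_integral_zero)
  have st: "set_integrable lborel {0<..} (\<lambda>s. of_real (s powr (- a)) / (1 + of_real s) :: complex)"
    by (rule stieltjes_set_integrable) (use assms in \<open>auto simp: complex_nonpos_Reals_iff\<close>)
  have eq: "indicator {0<..} s *\<^sub>R (of_real (s powr (- a)) / (1 + of_real s)) =
      complex_of_real (indicator {0<..} s * (s powr (- a) / (1 + s)))" for s
    by (auto simp: indicator_def)
  have st': "integrable lborel (\<lambda>s. indicator {0<..} s * (s powr (- a) / (1 + s)))"
    using st unfolding set_integrable_def eq by (simp only: complex_of_real_integrable_eq)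
  have int: "integrable (lborel \<Otimes>\<^sub>M lborel) (case_prod f)"
  proof (rule lborel_pair.Fubini_integrable)
    show "case_prod f \<in> borel_measurable (lborel \<Otimes>\<^sub>M lborel)"
      unfolding f_def by measurable
    have "(LBINT r. norm (case_prod f (s, r))) = indicator {0<..} s * (s powr (- a) / (1 + s))" for s
    proof -
      have "norm (case_prod f (s, r)) = f s r" for r
        by (auto simp: f_def indicator_def)
      then show ?thesis using fin[of s] by (simp add: has_bochner_integral_iff)
    qed
    then show "integrable lborel (\<lambda>s. LBINT r. norm (case_prod f (s, r)))"
      using st' by simp
    show "AE s in lborel. integrable lborel (\<lambda>r. case_prod f (s, r))"
      using fin by (simp add: has_bochner_integral_iff)
  qed
  have "stieltjes_power a 1 = of_real (LBINT s. indicator {0<..} s * (s powr (- a) / (1 + s)))"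
    unfolding stieltjes_power_def set_lebesgue_integral_def eq by (rule integral_complex_of_real)
  also have "(LBINT s. indicator {0<..} s * (s powr (- a) / (1 + s))) = (LBINT s. LBINT r. f s r)"
    using fin by (simp add: has_bochner_integral_iff)
  also have "\<dots> = (LBINT r. LBINT s. f s r)"
    by (rule lborel_pair.Fubini_integral[OF int, symmetric])
  also have "\<dots> = (LBINT r. Gamma (1 - a) * (indicator {0<..} r * (r powr (a - 1) * exp (- (1 * r)))))"
    using fout by (simp add: has_bochner_integral_iff)
  also have "\<dots> = Gamma (1 - a) * Gamma a"
    using has_bochner_integral_Gamma_scaled[of a 1] assms
    by (simp add: has_bochner_integral_iff)
  finally show ?thesis by (simp add: mult.commute)
qed

lemma stieltjes_power_eq:
  assumes "0 < a" "a < 1" "z \<notin> \<real>\<^sub>\<le>\<^sub>0"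
  shows "stieltjes_power a z = of_real (Gamma a * Gamma (1 - a)) * z powr (- of_real a)"
proof -
  define K where "K = Gamma a * Gamma (1 - a)"
  have pos: "stieltjes_power a (of_real x) = of_real K * of_real x powr (- of_real a)" if "x > 0" for x
  proof -
    let ?f = "\<lambda>s. indicator {0<..} s *\<^sub>R (of_real (s powr (- a)) / (of_real x + of_real s)) :: complex"
    let ?g = "\<lambda>s. indicator {0<..} s *\<^sub>R (of_real (s powr (- a)) / (1 + of_real s)) :: complex"
    \<comment> \<open>Substitution of x s for s: the integrand is homogeneous of degree -1 - a in
      (x, s), the Jacobian contributes x, and \<open>x powr (- a)\<close> comes out.\<close>
    have "stieltjes_power a (of_real x) = \<bar>x\<bar> *\<^sub>R (LBINT s. ?f (0 + x * s))"
      unfolding stieltjes_power_def set_lebesgue_integral_def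
      by (rule lborel_integral_real_affine) (use that in simp)
    also have "(\<lambda>s. ?f (0 + x * s)) = (\<lambda>s. (x powr (- a) / x) *\<^sub>R ?g s)"
    proof
      fix s
      show "?f (0 + x * s) = (x powr (- a) / x) *\<^sub>R ?g s"
      proof (cases "s > 0")
        case True
        have "complex_of_real x + of_real (x * s) = of_real x * (1 + of_real s)"
          by (simp add: ring_distribs)
        moreover have "(x * s) powr (- a) = x powr (- a) * s powr (- a)"
          using True that by (simp add: powr_mult)
        ultimately show ?thesis
          using True that by (simp add: scaleR_conv_of_real)
      qed (use that in \<open>simp add: zero_less_mult_iff\<close>)
    qed
    also have "\<bar>x\<bar> *\<^sub>R (LBINT s. (x powr (- a) / x) *\<^sub>R ?g s) = x powr (- a) *\<^sub>R (LBINT s. ?g s)"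
      by (subst integral_scaleR_right) (use that in simp)
    also have "(LBINT s. ?g s) = of_real K"
      using stieltjes_power_one[OF assms(1,2)]
      by (simp add: stieltjes_power_def set_lebesgue_integral_def K_def)
    also have "x powr (- a) *\<^sub>R complex_of_real K = of_real K * of_real x powr (- of_real a)"
      using that powr_of_real[of x "- a"] by (simp add: scaleR_conv_of_real)
    finally show ?thesis .
  qed
  \<comment> \<open>The identity theorem applies because the positive axis accumulates at 1 and the
    slit plane, being starlike, is connected.\<close>
  have "stieltjes_power a z - of_real K * z powr (- of_real a) = 0"
  proof (rule analytic_continuation[where
        f = "\<lambda>z. stieltjes_power a z - of_real K * z powr (- of_real a)" and w = z and S = "- \<real>\<^sub>\<le>\<^sub>0" and U = "complex_of_real ` {0<..}" and \<xi> = 1])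
    show "(\<lambda>z. stieltjes_power a z - of_real K * z powr (- of_real a)) holomorphic_on - \<real>\<^sub>\<le>\<^sub>0"
      using stieltjes_power_holomorphic[OF assms(1,2)]
      by (intro holomorphic_intros) auto
    show "open (- \<real>\<^sub>\<le>\<^sub>0 :: complex set)" by auto
    show "connected (- \<real>\<^sub>\<le>\<^sub>0 :: complex set)"
      using starlike_imp_connected[OF starlike_slotted_complex_plane_left[of 0]]
      by (simp add: nonpos_Reals_def image_def Collect_conj_eq atMost_def Bex_def conj_commute)
    show "of_real ` {0<..} \<subseteq> (- \<real>\<^sub>\<le>\<^sub>0 :: complex set)"
      by (auto simp: complex_nonpos_Reals_iff)
    show "1 \<in> (- \<real>\<^sub>\<le>\<^sub>0 :: complex set)" "z \<in> - \<real>\<^sub>\<le>\<^sub>0"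
      using assms by (auto simp: complex_nonpos_Reals_iff)
    show "(1::complex) islimpt of_real ` {0<..}"
      unfolding islimpt_approachable
    proof (intro allI impI)
      fix e :: real assume "0 < e"
      then show "\<exists>x'\<in>complex_of_real ` {0<..}. x' \<noteq> 1 \<and> dist x' 1 < e"
        by (intro bexI[OF _ imageI[of "1 + e / 2"]]) (auto simp: dist_norm)
    qed
    show "\<And>z. z \<in> of_real ` {0<..} \<Longrightarrow> stieltjes_power a z - of_real K * z powr (- of_real a) = 0"
      using pos by auto
  qed
  then show ?thesis by (simp add: K_def)
qed

text \<open>As 1/(z+s) - 1/z = -s / (z (z+s)), the subtraction cancels one power of s and leaves
  -1/z times the Stieltjes transform, which has no cancellation left.\<close>

lemma one_sided_kernel:
  fixes z :: complex
  assumes "0 < a" "a < 1" "z \<notin> \<real>\<^sub>\<le>\<^sub>0"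
  shows "set_integrable lborel {0<..} (\<lambda>s. (1 / (z + of_real s) - 1 / z) /\<^sub>R s powr (1 + a))"
    and "(LBINT s:{0<..}. (1 / (z + of_real s) - 1 / z) /\<^sub>R s powr (1 + a)) =
      - of_real (Gamma a * Gamma (1 - a)) * z powr (- 1 - of_real a)"
proof -
  have eq: "indicator {0<..} s *\<^sub>R ((1 / (z + of_real s) - 1 / z) /\<^sub>R s powr (1 + a)) =
      - (1 / z) * (indicator {0<..} s *\<^sub>R (of_real (s powr (- a)) / (z + of_real s)))" for s
  proof (cases "s > 0")
    case True
    obtain c where "c > 0" "\<And>s. s \<ge> 0 \<Longrightarrow> c * (1 + s) \<le> cmod (z + of_real s)"
      using slit_plane_lower_bound[OF assms(3)] by blast
    with True have nz: "z + of_real s \<noteq> 0"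
      by (smt (verit) mult_pos_pos norm_zero)
    have nz': "z \<noteq> 0" using assms(3) by auto
    have "1 / (z + of_real s) - 1 / z = - (of_real s / (z * (z + of_real s)))"
      using nz nz' by (simp add: field_simps)
    moreover have "s * inverse (s powr (1 + a)) = s powr (- a)"
      using True by (simp add: powr_add powr_minus field_simps)
    ultimately have "(1 / (z + of_real s) - 1 / z) /\<^sub>R s powr (1 + a) =
       - (of_real (s powr (- a)) / (z * (z + of_real s)))"
      by (simp add: scaleR_conv_of_real flip: of_real_mult)
         (simp add: mult.commute flip: of_real_mult of_real_inverse)
    then show ?thesis using True by simp
  qed simp
  show "set_integrable lborel {0<..} (\<lambda>s. (1 / (z + of_real s) - 1 / z) /\<^sub>R s powr (1 + a))"
    unfolding set_integrable_def eq
    by (rule integrable_mult_right)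
       (use stieltjes_set_integrable[OF assms] in \<open>simp add: set_integrable_def\<close>)
  have "(LBINT s:{0<..}. (1 / (z + of_real s) - 1 / z) /\<^sub>R s powr (1 + a)) = - (1 / z) * stieltjes_power a z"
    unfolding set_lebesgue_integral_def eq stieltjes_power_def by (rule integral_mult_right_zero)
  also have "\<dots> = - of_real (Gamma a * Gamma (1 - a)) * z powr (- 1 - of_real a)"
    unfolding stieltjes_power_eq[OF assms] using assms(3)
    by (subst powr_diff) (auto simp: powr_minus_divide field_simps)
  finally show "(LBINT s:{0<..}. (1 / (z + of_real s) - 1 / z) /\<^sub>R s powr (1 + a)) =
      - of_real (Gamma a * Gamma (1 - a)) * z powr (- 1 - of_real a)" .
qed

text \<open>Since 1/(z-s) = -1/(-z+s), the second difference of 1/z is a difference of one-sided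
  kernels at z and at -z. For Im z > 0 both points avoid the slit.\<close>

lemma two_sided_kernel:
  fixes z :: complex
  assumes "0 < a" "a < 1" "Im z > 0"
  shows "set_integrable lborel {0<..}
      (\<lambda>s. (1 / (z + of_real s) + 1 / (z - of_real s) - 2 / z) /\<^sub>R s powr (1 + a))"
    and "(LBINT s:{0<..}. (1 / (z + of_real s) + 1 / (z - of_real s) - 2 / z) /\<^sub>R s powr (1 + a)) =
      - of_real (Gamma a * Gamma (1 - a)) * z powr (- 1 - of_real a) * (1 + exp (\<i> * of_real (pi * a)))"
proof -
  have z: "z \<notin> \<real>\<^sub>\<le>\<^sub>0" "- z \<notin> \<real>\<^sub>\<le>\<^sub>0" "z \<noteq> 0"
    using assms(3) by (auto simp: complex_nonpos_Reals_iff)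
  have eq: "(1 / (z + of_real s) + 1 / (z - of_real s) - 2 / z) /\<^sub>R s powr (1 + a) =
     (1 / (z + of_real s) - 1 / z) /\<^sub>R s powr (1 + a) -
     (1 / (- z + of_real s) - 1 / (- z)) /\<^sub>R s powr (1 + a)" for s
  proof -
    have "1 / (z - of_real s) = - (1 / (- z + of_real s))"
      by (metis add.commute diff_conv_add_uminus minus_diff_eq minus_divide_right)
    then have "1 / (z + of_real s) + 1 / (z - of_real s) - 2 / z =
      (1 / (z + of_real s) - 1 / z) - (1 / (- z + of_real s) - 1 / (- z))"
      by simp
    then show ?thesis by (simp only: scaleR_diff_right)
  qed
  show "set_integrable lborel {0<..}
      (\<lambda>s. (1 / (z + of_real s) + 1 / (z - of_real s) - 2 / z) /\<^sub>R s powr (1 + a))"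
    unfolding eq by (intro set_integral_diff one_sided_kernel z assms)
  \<comment> \<open>In the upper half-plane the argument of z is positive, so the principal argument
    of -z is obtained by subtracting pi. This choice of branch fixes the sign in e^(i pi a).\<close>
  have "Ln (- z) = Ln z - \<i> * of_real pi"
    using assms(3) z by (simp add: Ln_minus)
  then have "(- z) powr (- 1 - of_real a) = exp ((- 1 - of_real a) * (Ln z + - (\<i> * of_real pi)))"
    using z by (simp add: powr_def)
  also have "\<dots> = z powr (- 1 - of_real a) * exp ((- 1 - of_real a) * (- (\<i> * of_real pi)))"
    using z by (simp only: powr_def distrib_left exp_add if_False)
  also have "exp ((- 1 - of_real a) * (- (\<i> * of_real pi))) = - exp (\<i> * of_real (pi * a))"
    by (simp add: ring_distribs exp_add exp_diff mult_ac)
  finally have *: "(- z) powr (- 1 - of_real a) = - (z powr (- 1 - of_real a) * exp (\<i> * of_real (pi * a)))"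
    by simp
  show "(LBINT s:{0<..}. (1 / (z + of_real s) + 1 / (z - of_real s) - 2 / z) /\<^sub>R s powr (1 + a)) =
      - of_real (Gamma a * Gamma (1 - a)) * z powr (- 1 - of_real a) * (1 + exp (\<i> * of_real (pi * a)))"
    unfolding eq
    by (subst set_integral_diff(2)) (use one_sided_kernel[OF assms(1,2) z(1)] one_sided_kernel[OF assms(1,2) z(2)]
      in \<open>simp_all add: * algebra_simps\<close>)
qed


section \<open>Decay and increments of Schwartz functions\<close>

lemma vderiv_has_vector_derivative:
  assumes "schwartz u"
  shows "(vderiv m u has_vector_derivative vderiv (Suc m) u x) (at x)"
proof -
  have "vderiv m u differentiable at x" using assms by (simp add: schwartz_def)
  then show ?thesis by (simp add: vector_derivative_works vderiv_def)
qed

text \<open>The bounds with k = 0 and k = 2 add up to one on (1 + x^2) times the derivative; the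
  rate 1/(1+x^2) is chosen because it is integrable. The extra 1 in the witness makes the constant
  strictly positive.\<close>

lemma schwartz_inverse_square_decay:
  assumes "schwartz u"
  obtains C where "C > 0" "\<And>x. cmod (vderiv m u x) \<le> C / (1 + x\<^sup>2)"
proof -
  have "bounded (range (\<lambda>x. x ^ k *\<^sub>R vderiv m u x))" for k
    using assms by (simp add: schwartz_def)
  from this[of 0] this[of 2] obtain A B where
    A: "\<And>x. cmod (vderiv m u x) \<le> A" and B: "\<And>x. x\<^sup>2 * cmod (vderiv m u x) \<le> B"
    by (fastforce simp: bounded_iff)
  have "cmod (vderiv m u x) \<le> (\<bar>A\<bar> + \<bar>B\<bar> + 1) / (1 + x\<^sup>2)" for x
  proof -
    have "(1 + x\<^sup>2) * cmod (vderiv m u x) \<le> \<bar>A\<bar> + \<bar>B\<bar> + 1"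
      using A[of x] B[of x] by (simp add: ring_distribs)
    then show ?thesis by (simp add: pos_le_divide_eq add_pos_nonneg mult.commute)
  qed
  then show ?thesis by (intro that[of "\<bar>A\<bar> + \<bar>B\<bar> + 1"]) auto
qed

lemma vector_derivative_increment_bound:
  fixes f :: "real \<Rightarrow> 'a::real_normed_vector"
  assumes "\<And>t. t \<in> closed_segment x y \<Longrightarrow> (f has_vector_derivative f' t) (at t)"
    and "\<And>t. t \<in> closed_segment x y \<Longrightarrow> norm (f' t) \<le> B"
  shows "norm (f y - f x) \<le> B * \<bar>y - x\<bar>"
proof -
  have "norm (f y - f x) \<le> B * norm (y - x)"
  proof (rule differentiable_bound[where f' = "\<lambda>t h. h *\<^sub>R f' t"])
    fix t assume t: "t \<in> closed_segment x y"
    show "(f has_derivative (\<lambda>h. h *\<^sub>R f' t)) (at t within closed_segment x y)"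
      using assms(1)[OF t] unfolding has_vector_derivative_def by (rule has_derivative_at_withinI)
    show "onorm (\<lambda>h. h *\<^sub>R f' t) \<le> B"
      using assms(2)[OF t] by (intro onorm_le) (simp add: mult.commute[of B] mult_left_mono)
  qed auto
  then show ?thesis by simp
qed

text \<open>Allows the intermediate point of a mean value estimate with step at most 1 to be
  replaced by the endpoint x, at the cost of a factor 3.\<close>

lemma inverse_square_shift:
  fixes x y :: real
  assumes "\<bar>x - y\<bar> \<le> 1"
  shows "1 / (1 + y\<^sup>2) \<le> 3 / (1 + x\<^sup>2)"
proof -
  have "(x - y)\<^sup>2 \<le> 1" using assms by (simp add: abs_square_le_1)
  \<comment> \<open>A sum-of-squares certificate: expanded, the right side is 3 (1 + y^2) - (1 +
    x^2).\<close>
  then have "0 \<le> 2 * (1 - (x - y)\<^sup>2) + (x - 2 * y)\<^sup>2 + y\<^sup>2" by simp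
  also have "\<dots> = 3 * (1 + y\<^sup>2) - (1 + x\<^sup>2)" by (simp add: power2_eq_square algebra_simps)
  finally have "1 + x\<^sup>2 \<le> 3 * (1 + y\<^sup>2)" by simp
  then show ?thesis by (simp add: divide_simps add_pos_nonneg)
qed

text \<open>The estimates serve different ends: the second is integrable in x and small in s, which
  gives Fubini and integrability of L u; the third, an increment of increments, gives its Lipschitz
  continuity.\<close>

lemma schwartz_increments:
  assumes u: "schwartz u"
  obtains C where "C > 0"
    and "\<And>x. cmod (u x) \<le> C / (1 + x\<^sup>2)"
    and "\<And>x s. cmod (u (x + s) - u x) \<le> C * min 1 \<bar>s\<bar> * (1 / (1 + x\<^sup>2) + 1 / (1 + (x + s)\<^sup>2))"
    and "\<And>x y s. cmod ((u (x + s) - u x) - (u (y + s) - u y)) \<le> C * min 1 \<bar>s\<bar> * \<bar>x - y\<bar>"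
proof -
  obtain C0 where C0: "C0 > 0" "\<And>x. cmod (vderiv 0 u x) \<le> C0 / (1 + x\<^sup>2)"
    using schwartz_inverse_square_decay[OF u] by blast
  obtain C1 where C1: "C1 > 0" "\<And>x. cmod (vderiv 1 u x) \<le> C1 / (1 + x\<^sup>2)"
    using schwartz_inverse_square_decay[OF u] by blast
  obtain C2 where C2: "C2 > 0" "\<And>x. cmod (vderiv 2 u x) \<le> C2 / (1 + x\<^sup>2)"
    using schwartz_inverse_square_decay[OF u] by blast
  have v0: "vderiv 0 u = u" by (simp add: vderiv_def)
  have d0: "(u has_vector_derivative vderiv 1 u x) (at x)" for x
    using vderiv_has_vector_derivative[OF u, of 0 x] by (simp add: v0)
  have d1: "(vderiv 1 u has_vector_derivative vderiv 2 u x) (at x)" for x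
    using vderiv_has_vector_derivative[OF u, of 1 x] by (simp add: numeral_2_eq_2)
  have le_num: "K / (1 + x\<^sup>2) \<le> K" if "K > 0" for K x :: real
    using that by (simp add: divide_le_eq add_pos_nonneg)
  \<comment> \<open>One constant for all estimates: 3 C1 pays for the shifted mean value point,
    which also covers the sum of two first derivatives, and C2 for the Lipschitz constant of the
    first derivative.\<close>
  define C where "C = C0 + 3 * C1 + C2"
  have C: "C0 \<le> C" "3 * C1 \<le> C" "2 * C1 \<le> C" "C2 \<le> C" "C > 0" using C0 C1 C2 by (auto simp: C_def)
  have S1: "cmod (u x) \<le> C / (1 + x\<^sup>2)" for x
    using C0(2)[of x] divide_right_mono[OF C(1), of "1 + x\<^sup>2"] by (simp add: v0)
  \<comment> \<open>For steps of length at most 1 the mean value estimate gains the factor |s|; for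
    longer ones the values of u are bounded separately, which is where the weight at x + s comes
    from.\<close>
  have S2: "cmod (u (x + s) - u x) \<le> C * min 1 \<bar>s\<bar> * (1 / (1 + x\<^sup>2) + 1 / (1 + (x + s)\<^sup>2))" for x s
  proof (cases "\<bar>s\<bar> \<le> 1")
    case True
    have "norm (u (x + s) - u x) \<le> 3 * C1 / (1 + x\<^sup>2) * \<bar>x + s - x\<bar>"
    proof (rule vector_derivative_increment_bound[OF d0])
      fix t assume "t \<in> closed_segment x (x + s)"
      then have "\<bar>x - t\<bar> \<le> 1"
        using True by (auto simp: closed_segment_eq_real_ivl split: if_splits)
      from inverse_square_shift[OF this] have "C1 * (1 / (1 + t\<^sup>2)) \<le> C1 * (3 / (1 + x\<^sup>2))"
        using C1(1) by (intro mult_left_mono) auto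
      then show "norm (vderiv 1 u t) \<le> 3 * C1 / (1 + x\<^sup>2)"
        using C1(2)[of t] by (simp add: mult.commute)
    qed
    also have "\<dots> = 3 * C1 * \<bar>s\<bar> * (1 / (1 + x\<^sup>2))" by simp
    also have "\<dots> \<le> C * min 1 \<bar>s\<bar> * (1 / (1 + x\<^sup>2) + 1 / (1 + (x + s)\<^sup>2))"
      using True C by (intro mult_mono) auto
    finally show ?thesis .
  next
    case False
    have "cmod (u (x + s) - u x) \<le> C / (1 + (x + s)\<^sup>2) + C / (1 + x\<^sup>2)"
      using norm_triangle_ineq4[of "u (x + s)" "u x"] S1[of "x + s"] S1[of x] by linarith
    also have "\<dots> = C * min 1 \<bar>s\<bar> * (1 / (1 + x\<^sup>2) + 1 / (1 + (x + s)\<^sup>2))"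
      using False by (simp add: ring_distribs)
    finally show ?thesis .
  qed
  \<comment> \<open>Mean value estimate in x for the increment with fixed step s. Its derivative
    u'(x+s) - u'(x) is bounded both by 2 C1 and by C2 |s|, hence by a multiple of
    \<open>min 1 \<bar>s\<bar>\<close>.\<close>
  have S3: "cmod ((u (x + s) - u x) - (u (y + s) - u y)) \<le> C * min 1 \<bar>s\<bar> * \<bar>x - y\<bar>" for x y s
  proof (rule vector_derivative_increment_bound[where f = "\<lambda>x. u (x + s) - u x" and
        f' = "\<lambda>x. vderiv 1 u (x + s) - vderiv 1 u x"])
    fix t
    have "((u \<circ> (\<lambda>x. x + s)) has_vector_derivative (1 *\<^sub>R vderiv 1 u (t + s))) (at t)"
      by (rule vector_diff_chain_at) (use d0 in \<open>auto intro!: derivative_eq_intros\<close>)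
    then have "((\<lambda>x. u (x + s)) has_vector_derivative vderiv 1 u (t + s)) (at t)"
      by (simp add: o_def)
    then show "((\<lambda>x. u (x + s) - u x) has_vector_derivative vderiv 1 u (t + s) - vderiv 1 u t) (at t)"
      by (intro has_vector_derivative_diff d0)
    have "norm (vderiv 1 u (t + s) - vderiv 1 u t) \<le> C1 + C1"
      using norm_triangle_ineq4[of "vderiv 1 u (t + s)" "vderiv 1 u t"]
        C1(2)[of "t + s"] C1(2)[of t] le_num[OF C1(1), of "t + s"] le_num[OF C1(1), of t] by linarith
    then have a: "norm (vderiv 1 u (t + s) - vderiv 1 u t) \<le> C" using C by linarith
    have "norm (vderiv 1 u (t + s) - vderiv 1 u t) \<le> C2 * \<bar>t + s - t\<bar>"
      by (rule vector_derivative_increment_bound[OF d1]) (use C2(2) le_num[OF C2(1)] order_trans in blast)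
    also have "\<dots> \<le> C * \<bar>s\<bar>" using C by (simp add: mult_right_mono)
    finally show "norm (vderiv 1 u (t + s) - vderiv 1 u t) \<le> C * min 1 \<bar>s\<bar>"
      using a by (simp add: min_def)
  qed
  show ?thesis by (rule that[OF C(5) S1 S2 S3])
qed

lemma schwartz_continuous:
  assumes "schwartz u"
  shows "continuous_on UNIV u"
proof -
  have "(u has_vector_derivative vderiv 1 u x) (at x)" for x
    using vderiv_has_vector_derivative[OF assms, of 0 x] by (simp add: vderiv_def)
  then show ?thesis
    using has_vector_derivative_continuous continuous_at_imp_continuous_on by blast
qed

lemma integrable_inverse_one_plus_square: "integrable lborel (\<lambda>x::real. 1 / (1 + x\<^sup>2))"
proof -
  have "(\<lambda>x::real. 1 / (1 + x\<^sup>2)) = (\<lambda>x. inverse (1 + x\<^sup>2))" by (auto simp: field_simps)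
  then show ?thesis
    using integrable_inverse_1_plus_square by (simp add: set_integrable_def)
qed

lemma schwartz_integrable:
  assumes "schwartz u"
  shows "integrable lborel u"
proof -
  obtain C where C: "C > 0" "\<And>x. cmod (u x) \<le> C / (1 + x\<^sup>2)"
    using schwartz_increments[OF assms] by metis
  show ?thesis
  proof (rule Bochner_Integration.integrable_bound)
    show "integrable lborel (\<lambda>x. C * (1 / (1 + x\<^sup>2)))"
      using integrable_inverse_one_plus_square by (rule integrable_mult_right)
    show "u \<in> borel_measurable lborel"
      using borel_measurable_continuous_onI[OF schwartz_continuous[OF assms]] by simp
    show "AE x in lborel. norm (u x) \<le> norm (C * (1 / (1 + x\<^sup>2)))"
      using C by (intro AE_I2) (smt (verit) mult_cancel_left1 times_divide_eq_right real_norm_def)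
  qed
qed


section \<open>Second differences and the hypersingular integral\<close>

text \<open>Generic in the codomain, as is \<open>hypersingular\<close>, because the same operator
  is applied to the complex function u and, after transposition, to a real kernel.\<close>

definition second_difference :: "(real \<Rightarrow> 'a::real_vector) \<Rightarrow> real \<Rightarrow> real \<Rightarrow> 'a" where
  "second_difference u s x = u (x + s) + u (x - s) - 2 *\<^sub>R u x"

definition hypersingular ::
    "real \<Rightarrow> (real \<Rightarrow> 'a::{banach, second_countable_topology}) \<Rightarrow> real \<Rightarrow> 'a" where
  "hypersingular a u x = (LBINT s:{0<..}. second_difference u s x /\<^sub>R s powr (1 + a))"

lemma weighted_bound:
  fixes v :: "'a::real_normed_vector"
  assumes "s > 0 \<Longrightarrow> norm v \<le> B * min 1 s"
  shows "norm (indicator {0<..} s *\<^sub>R (v /\<^sub>R s powr (1 + a))) \<le> B * truncated_weight a s"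
proof (cases "s > 0")
  case True
  then have "norm v / s powr (1 + a) \<le> B * min 1 s / s powr (1 + a)"
    using assms by (intro divide_right_mono) auto
  then show ?thesis using True by (simp add: truncated_weight_def divide_inverse mult_ac)
qed (simp add: truncated_weight_def)

lemma weighted_set_integrable:
  fixes f :: "real \<Rightarrow> 'a::{banach, second_countable_topology}"
  assumes "0 < a" "a < 1" and [measurable]: "f \<in> borel_measurable borel"
    and "\<And>s. s > 0 \<Longrightarrow> norm (f s) \<le> B * min 1 s"
  shows "set_integrable lborel {0<..} (\<lambda>s. f s /\<^sub>R s powr (1 + a))"
  unfolding set_integrable_def
proof (rule Bochner_Integration.integrable_bound)
  show "integrable lborel (\<lambda>s. B * truncated_weight a s)"
    using integrable_truncated_weight[OF assms(1,2)] by simp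
  show "AE s in lborel. norm (indicator {0<..} s *\<^sub>R (f s /\<^sub>R s powr (1 + a))) \<le> norm (B * truncated_weight a s)"
    using weighted_bound[OF assms(4), of _ a] by (intro AE_I2) (smt (verit) real_norm_def)
qed measurable

text \<open>The majorant in x may vary with s, as translates of one profile do; only the integrals
  of these majorants need a common bound M.\<close>

lemma integrable_pair_dominated:
  fixes f :: "real \<times> real \<Rightarrow> 'a::{banach, second_countable_topology}"
  assumes [measurable]: "f \<in> borel_measurable (lborel \<Otimes>\<^sub>M lborel)"
    and k: "integrable lborel k" "\<And>s. 0 \<le> k s"
    and g: "\<And>s. integrable lborel (g s)" "\<And>s. (LBINT x. g s x) \<le> M"
    and f: "\<And>s x. norm (f (s, x)) \<le> k s * g s x"
  shows "integrable (lborel \<Otimes>\<^sub>M lborel) f"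
proof (rule lborel_pair.Fubini_integrable)
  have int: "integrable lborel (\<lambda>x. f (s, x))" for s
  proof (rule Bochner_Integration.integrable_bound)
    show "integrable lborel (\<lambda>x. k s * g s x)" using g(1) by simp
    show "AE x in lborel. norm (f (s, x)) \<le> norm (k s * g s x)"
      using f by (intro AE_I2) (smt (verit) real_norm_def)
  qed measurable
  then show "AE s in lborel. integrable lborel (\<lambda>x. f (s, x))" by simp
  show "integrable lborel (\<lambda>s. LBINT x. norm (f (s, x)))"
  proof (rule Bochner_Integration.integrable_bound)
    show "integrable lborel (\<lambda>s. M * k s)" using k by simp
    have "(LBINT x. norm (f (s, x))) \<le> M * k s" for s
    proof -
      have "(LBINT x. norm (f (s, x))) \<le> (LBINT x. k s * g s x)"
        by (rule integral_mono) (use int g f in auto)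
      also have "\<dots> = k s * (LBINT x. g s x)" by simp
      also have "\<dots> \<le> k s * M" by (intro mult_left_mono g k)
      finally show ?thesis by (simp add: mult.commute)
    qed
    moreover have "0 \<le> (LBINT x. norm (f (s, x)))" for s
      by (rule integral_nonneg_AE) simp
    ultimately show "AE s in lborel. norm (LBINT x. norm (f (s, x))) \<le> norm (M * k s)"
      by (intro AE_I2) (smt (verit) real_norm_def)
  qed measurable
qed measurable

lemma second_difference_schwartz_bound:
  fixes u :: "real \<Rightarrow> complex"
  assumes "\<And>x s. cmod (u (x + s) - u x) \<le> C * min 1 \<bar>s\<bar> * (1 / (1 + x\<^sup>2) + 1 / (1 + (x + s)\<^sup>2))"
  shows "cmod (second_difference u s x) \<le>
    C * min 1 \<bar>s\<bar> * (2 / (1 + x\<^sup>2) + 1 / (1 + (x + s)\<^sup>2) + 1 / (1 + (x - s)\<^sup>2))"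
proof -
  have "second_difference u s x = (u (x + s) - u x) + (u (x + - s) - u x)"
    by (simp add: second_difference_def scaleR_2)
  then have "cmod (second_difference u s x) \<le> cmod (u (x + s) - u x) + cmod (u (x + - s) - u x)"
    by (simp only: norm_triangle_ineq)
  also have "\<dots> \<le> C * min 1 \<bar>s\<bar> * (1 / (1 + x\<^sup>2) + 1 / (1 + (x + s)\<^sup>2)) +
     C * min 1 \<bar>- s\<bar> * (1 / (1 + x\<^sup>2) + 1 / (1 + (x + - s)\<^sup>2))"
    by (intro add_mono assms)
  also have "\<dots> = C * min 1 \<bar>s\<bar> * (2 / (1 + x\<^sup>2) + 1 / (1 + (x + s)\<^sup>2) + 1 / (1 + (x - s)\<^sup>2))"
    by (simp add: ring_distribs add_divide_distrib)
  finally show ?thesis .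
qed

lemma inverse_one_plus_square_le_1: "1 / (1 + x\<^sup>2) \<le> (1::real)"
  by (simp add: divide_le_eq add_pos_nonneg)

lemma schwartz_increment_uniform_bound:
  fixes u :: "real \<Rightarrow> complex"
  assumes "C > 0" "\<And>x s. cmod (u (x + s) - u x) \<le> C * min 1 \<bar>s\<bar> * (1 / (1 + x\<^sup>2) + 1 / (1 + (x + s)\<^sup>2))"
  shows "cmod (u (x + s) - u x) \<le> 2 * C * min 1 \<bar>s\<bar>"
proof -
  have "C * min 1 \<bar>s\<bar> * (1 / (1 + x\<^sup>2) + 1 / (1 + (x + s)\<^sup>2)) \<le> C * min 1 \<bar>s\<bar> * (1 + 1)"
    using assms(1) by (intro mult_left_mono add_mono inverse_one_plus_square_le_1) auto
  with assms(2)[of x s] show ?thesis by (simp add: mult_ac)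
qed

lemma second_difference_uniform_bound:
  fixes u :: "real \<Rightarrow> 'a::real_normed_vector"
  assumes "\<And>x s. norm (u (x + s) - u x) \<le> B * min 1 \<bar>s\<bar>"
  shows "norm (second_difference u s x) \<le> 2 * B * min 1 \<bar>s\<bar>"
proof -
  have "second_difference u s x = (u (x + s) - u x) + (u (x + - s) - u x)"
    by (simp add: second_difference_def scaleR_2)
  then show ?thesis
    using norm_triangle_ineq[of "u (x + s) - u x" "u (x + - s) - u x"] assms[of x s] assms[of x "- s"]
    by simp
qed

text \<open>The bounded factor b gives the lemma two uses: the constant 1 yields integrability of L
  u, and a translated kernel yields the Fubini step of the transposition.\<close>

lemma schwartz_hypersingular_pair_integrable:
  fixes b :: "real \<Rightarrow> real"
  assumes a: "0 < a" "a < 1" and u: "schwartz u"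
    and b[measurable]: "b \<in> borel_measurable borel" "\<And>x. \<bar>b x\<bar> \<le> B"
  shows "integrable (lborel \<Otimes>\<^sub>M lborel)
    (\<lambda>(s, x). indicator {0<..} s *\<^sub>R (b x *\<^sub>R (second_difference u s x /\<^sub>R s powr (1 + a))))"
proof -
  obtain C where C: "C > 0"
    "\<And>x s. cmod (u (x + s) - u x) \<le> C * min 1 \<bar>s\<bar> * (1 / (1 + x\<^sup>2) + 1 / (1 + (x + s)\<^sup>2))"
    using schwartz_increments[OF u] by metis
  have [measurable]: "u \<in> borel_measurable borel"
    by (rule borel_measurable_continuous_onI[OF schwartz_continuous[OF u]])
  have B: "B \<ge> 0" using b(2)[of 0] by linarith
  let ?p = "\<lambda>x::real. 1 / (1 + x\<^sup>2)"
  let ?g = "\<lambda>s x. B * C * (2 * ?p x + ?p (x + s) + ?p (x - s))"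
  note p = integrable_inverse_one_plus_square
  have pn: "0 \<le> ?p x" for x by simp
  show ?thesis
  proof (rule integrable_pair_dominated[where k = "truncated_weight a" and g = ?g])
    show "integrable lborel (truncated_weight a)" by (rule integrable_truncated_weight[OF a])
    show "integrable lborel (?g s)" for s
      by (intro integrable_mult_right Bochner_Integration.integrable_add p
           integrable_translation[OF p])
    \<comment> \<open>By translation invariance the mass does not depend on s: the profile is
      counted 2 + 1 + 1 times.\<close>
    show "(LBINT x. ?g s x) \<le> B * C * (4 * (LBINT x. ?p x))" for s
    proof -
      have "(LBINT x. 2 * ?p x + ?p (x + s) + ?p (x - s)) =
          (LBINT x. 2 * ?p x) + (LBINT x. ?p (x + s)) + (LBINT x. ?p (x - s))"
        using p integrable_translation[OF p, of s]
        by (simp only: Bochner_Integration.integral_add Bochner_Integration.integrable_add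
            integrable_mult_right)
      also have "\<dots> = 4 * (LBINT x. ?p x)"
        using integral_translation[of ?p s] by (simp only: integral_mult_right_zero)
      finally show ?thesis by (simp only: integral_mult_right_zero)
    qed
    show "norm (case (s, x) of (s, x) \<Rightarrow> indicator {0<..} s *\<^sub>R
        (b x *\<^sub>R (second_difference u s x /\<^sub>R s powr (1 + a)))) \<le> truncated_weight a s * ?g s x" for s x
    proof -
      define S where "S = 2 * ?p x + ?p (x + s) + ?p (x - s)"
      have S0: "S \<ge> 0" unfolding S_def by (intro add_nonneg_nonneg mult_nonneg_nonneg pn) auto
      have sd: "cmod (second_difference u s x) \<le> C * min 1 \<bar>s\<bar> * S"
        using second_difference_schwartz_bound[of u C s x] C(2) by (simp add: S_def)
      have "norm (indicator {0<..} s *\<^sub>R ((b x *\<^sub>R second_difference u s x) /\<^sub>R s powr (1 + a)))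
          \<le> B * C * S * truncated_weight a s"
      proof (rule weighted_bound)
        assume s: "s > 0"
        have "norm (b x *\<^sub>R second_difference u s x) \<le> B * (C * min 1 \<bar>s\<bar> * S)"
          unfolding norm_scaleR using sd b(2)[of x] B by (intro mult_mono) auto
        then show "norm (b x *\<^sub>R second_difference u s x) \<le> B * C * S * min 1 s"
          using s by (simp add: mult_ac)
      qed
      then show ?thesis by (simp add: S_def mult_ac)
    qed
  qed (auto simp: truncated_weight_nonneg second_difference_def[abs_def])
qed

lemma schwartz_hypersingular_set_integrable:
  assumes "0 < a" "a < 1" and u: "schwartz u"
  shows "set_integrable lborel {0<..} (\<lambda>s. second_difference u s x /\<^sub>R s powr (1 + a))"
proof -
  obtain C where C: "C > 0"
    "\<And>x s. cmod (u (x + s) - u x) \<le> C * min 1 \<bar>s\<bar> * (1 / (1 + x\<^sup>2) + 1 / (1 + (x + s)\<^sup>2))"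
    using schwartz_increments[OF u] by metis
  have [measurable]: "u \<in> borel_measurable borel"
    by (rule borel_measurable_continuous_onI[OF schwartz_continuous[OF u]])
  show ?thesis
  proof (rule weighted_set_integrable[OF assms(1,2)])
    show "norm (second_difference u s x) \<le> 2 * (2 * C) * min 1 s" if "s > 0" for s
      using second_difference_uniform_bound[of u "2 * C" s x] schwartz_increment_uniform_bound[OF C] that by simp
  qed (simp add: second_difference_def[abs_def])
qed

lemma schwartz_hypersingular_integrable:
  assumes "0 < a" "a < 1" and u: "schwartz u"
  shows "integrable lborel (hypersingular a u)"
  using lborel_pair.integrable_snd[OF schwartz_hypersingular_pair_integrable[OF assms, of "\<lambda>_. 1" 1]]
  by (simp add: hypersingular_def[abs_def] set_lebesgue_integral_def)

text \<open>The difference of second differences at x and y splits into two increments of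
  increments, with steps s and -s. Each is O(min(1,|s|) |x-y|), and the weight integrates the
  rest.\<close>

lemma schwartz_hypersingular_lipschitz:
  assumes a: "0 < a" "a < 1" and u: "schwartz u"
  obtains L where "\<And>x y. cmod (hypersingular a u x - hypersingular a u y) \<le> L * \<bar>x - y\<bar>"
proof -
  obtain C where C: "C > 0"
    "\<And>x y s. cmod ((u (x + s) - u x) - (u (y + s) - u y)) \<le> C * min 1 \<bar>s\<bar> * \<bar>x - y\<bar>"
    using schwartz_increments[OF u] by metis
  have "cmod (hypersingular a u x - hypersingular a u y) \<le>
      2 * C * (LBINT s. truncated_weight a s) * \<bar>x - y\<bar>" for x y
  proof -
    let ?d = "\<lambda>s. indicator {0<..} s *\<^sub>R ((second_difference u s x - second_difference u s y) /\<^sub>R s powr (1 + a))"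
    have eq: "hypersingular a u x - hypersingular a u y = (LBINT s. ?d s)"
      unfolding hypersingular_def
      by (subst set_integral_diff(2)[symmetric])
         (use schwartz_hypersingular_set_integrable[OF assms]
           in \<open>auto simp: scaleR_diff_right set_lebesgue_integral_def\<close>)
    have int: "integrable lborel ?d"
      using set_integral_diff(1)[OF schwartz_hypersingular_set_integrable[OF assms, of x]
          schwartz_hypersingular_set_integrable[OF assms, of y]]
      by (simp add: set_integrable_def scaleR_diff_right)
    have bd: "norm (?d s) \<le> 2 * C * \<bar>x - y\<bar> * truncated_weight a s" for s
    proof (rule weighted_bound)
      assume "s > 0"
      have "second_difference u s x - second_difference u s y =
         ((u (x + s) - u x) - (u (y + s) - u y)) + ((u (x + - s) - u x) - (u (y + - s) - u y))"
        by (simp add: second_difference_def scaleR_2)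
      then have "cmod (second_difference u s x - second_difference u s y) \<le>
          cmod ((u (x + s) - u x) - (u (y + s) - u y)) + cmod ((u (x + - s) - u x) - (u (y + - s) - u y))"
        by (simp only: norm_triangle_ineq)
      also have "\<dots> \<le> C * min 1 \<bar>s\<bar> * \<bar>x - y\<bar> + C * min 1 \<bar>- s\<bar> * \<bar>x - y\<bar>"
        by (intro add_mono C)
      finally show "cmod (second_difference u s x - second_difference u s y) \<le> 2 * C * \<bar>x - y\<bar> * min 1 s"
        using \<open>s > 0\<close> by (simp add: mult_ac)
    qed
    have "cmod (LBINT s. ?d s) \<le> (LBINT s. norm (?d s))" by (rule integral_norm_bound)
    also have "\<dots> \<le> (LBINT s. 2 * C * \<bar>x - y\<bar> * truncated_weight a s)"
    proof (rule integral_mono)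
      show "integrable lborel (\<lambda>s. norm (?d s))" by (rule integrable_norm[OF int])
      show "integrable lborel (\<lambda>s. 2 * C * \<bar>x - y\<bar> * truncated_weight a s)"
        by (rule integrable_mult_right) (rule integrable_truncated_weight[OF a])
    qed (rule bd)
    also have "\<dots> = 2 * C * (LBINT s. truncated_weight a s) * \<bar>x - y\<bar>" by simp
    finally show ?thesis unfolding eq .
  qed
  then show ?thesis by (rule that)
qed

section \<open>Hilbert transform of integrable Lipschitz functions\<close>

text \<open>Folding turns both integrals into integrals of f(x+t) - f(x-t) over t > 0, against 1/t
  and t/(t^2+y^2). As the second kernel is at most the first, one majorant serves both: 2L for t <=
  1 by the Lipschitz condition, and |f(x+t)| + |f(x-t)| beyond.\<close>

lemma hilbert_pv_lipschitz:
  fixes f :: "real \<Rightarrow> complex"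
  assumes f: "integrable lborel f" and L: "\<And>x y. cmod (f x - f y) \<le> L * \<bar>x - y\<bar>"
  shows "pv_converges x (\<lambda>t. f t /\<^sub>R (t - x))"
    and "((\<lambda>y. LBINT t. (t / (t\<^sup>2 + y\<^sup>2)) *\<^sub>R f (x + t)) \<longlongrightarrow> pv_integral x (\<lambda>t. f t /\<^sub>R (t - x))) (at_right 0)"
proof -
  let ?g = "\<lambda>t. f t /\<^sub>R (t - x)"
  let ?w = "\<lambda>t. 2 * L * indicator {0..1} t + (norm (f (x + t)) + norm (f (x - t)))"
  have [measurable]: "f \<in> borel_measurable borel"
    using borel_measurable_integrable[OF f] by simp
  have f': "integrable lborel (\<lambda>t. f (x + t))" "integrable lborel (\<lambda>t. f (x - t))"
    using integrable_translation(3)[OF f, of x] integrable_reflect[OF integrable_translation(3)[OF f, of x]]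
    by auto
  have L0: "L \<ge> 0" using order_trans[OF norm_ge_zero L[of 1 0]] by simp
  have w: "integrable lborel ?w"
    by (intro Bochner_Integration.integrable_add integrable_mult_right integrable_norm f') auto
  have bd: "norm ((f (x + t) - f (x - t)) /\<^sub>R t) \<le> ?w t" if "t > 0" for t
  proof (cases "t \<le> 1")
    case True
    have "norm (f (x + t) - f (x - t)) \<le> L * \<bar>(x + t) - (x - t)\<bar>" by (rule L)
    then have "norm (f (x + t) - f (x - t)) / t \<le> 2 * L" using that by (simp add: divide_le_eq)
    then show ?thesis using True that by (simp add: divide_inverse mult.commute add_increasing2)
  next
    case False
    have "norm ((f (x + t) - f (x - t)) /\<^sub>R t) = norm (f (x + t) - f (x - t)) / t"
      using that by (simp add: divide_inverse mult.commute)
    also have "\<dots> \<le> norm (f (x + t) - f (x - t))"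
      using False by (simp add: divide_le_eq mult_le_cancel_left1)
    also have "\<dots> \<le> ?w t" using norm_triangle_ineq4[of "f (x + t)" "f (x - t)"] False by simp
    finally show ?thesis .
  qed
  have odd: "?g (x + t) + ?g (x - t) = (f (x + t) - f (x - t)) /\<^sub>R t" for t
    by (simp add: scaleR_diff_right)
  have si: "set_integrable lborel {0<..} (\<lambda>t. ?g (x + t) + ?g (x - t))"
    unfolding set_integrable_def odd
  proof (rule Bochner_Integration.integrable_bound[OF w])
    show "AE t in lborel. norm (indicator {0<..} t *\<^sub>R ((f (x + t) - f (x - t)) /\<^sub>R t)) \<le> norm (?w t)"
    proof (rule AE_I2)
      fix t
      show "norm (indicator {0<..} t *\<^sub>R ((f (x + t) - f (x - t)) /\<^sub>R t)) \<le> norm (?w t)"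
        using bd[of t] by (cases "t > 0") (auto simp: abs_of_nonneg)
    qed
  qed measurable
  have tail: "set_integrable lborel {t. \<bar>t - x\<bar> > e} ?g" if "e > 0" for e
    unfolding set_integrable_def
  proof (rule Bochner_Integration.integrable_bound)
    show "integrable lborel (\<lambda>t. (1 / e) *\<^sub>R f t)" using f by simp
    show "AE t in lborel. norm (indicator {t. e < \<bar>t - x\<bar>} t *\<^sub>R ?g t) \<le> norm ((1 / e) *\<^sub>R f t)"
    proof (rule AE_I2)
      fix t
      show "norm (indicator {t. e < \<bar>t - x\<bar>} t *\<^sub>R ?g t) \<le> norm ((1 / e) *\<^sub>R f t)"
      proof (cases "e < \<bar>t - x\<bar>")
        case True
        then have "inverse \<bar>t - x\<bar> \<le> inverse e" using that by (intro le_imp_inverse_le) auto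
        then show ?thesis using True that
          by (simp add: mult_right_mono divide_inverse)
      qed simp
    qed
  qed measurable
  show "pv_converges x ?g" by (rule pv_symmetric_pair(1)[OF tail si])
  have pv: "pv_integral x ?g = (LBINT t. indicator {0<..} t *\<^sub>R ((f (x + t) - f (x - t)) /\<^sub>R t))"
    using pv_symmetric_pair(2)[OF tail si] unfolding odd set_lebesgue_integral_def by simp
  have q: "(LBINT t. (t / (t\<^sup>2 + y\<^sup>2)) *\<^sub>R f (x + t)) =
      (LBINT t. indicator {0<..} t *\<^sub>R ((t / (t\<^sup>2 + y\<^sup>2)) *\<^sub>R (f (x + t) - f (x - t))))"
    if "y > 0" for y
  proof -
    \<comment> \<open>Folding needs absolute convergence over the whole line. For fixed y it holds
      because |t| y <= t^2 + y^2 bounds the kernel by 1/y.\<close>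
    have "integrable lborel (\<lambda>t. (t / (t\<^sup>2 + y\<^sup>2)) *\<^sub>R f (x + t))"
    proof (rule Bochner_Integration.integrable_bound)
      show "integrable lborel (\<lambda>t. (1 / y) *\<^sub>R f (x + t))" using f' by simp
      show "AE t in lborel. norm ((t / (t\<^sup>2 + y\<^sup>2)) *\<^sub>R f (x + t)) \<le> norm ((1 / y) *\<^sub>R f (x + t))"
      proof (rule AE_I2)
        fix t
        have "\<bar>t\<bar> * y \<le> t\<^sup>2 + y\<^sup>2"
          using sum_squares_bound[of "\<bar>t\<bar>" y] mult_nonneg_nonneg[of "\<bar>t\<bar>" y] that
          unfolding power2_abs by linarith
        then have "\<bar>t\<bar> / (t\<^sup>2 + y\<^sup>2) \<le> 1 / y"
          using that by (simp add: divide_simps add_nonneg_pos)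
        then show "norm ((t / (t\<^sup>2 + y\<^sup>2)) *\<^sub>R f (x + t)) \<le> norm ((1 / y) *\<^sub>R f (x + t))"
          using that unfolding norm_scaleR by (intro mult_right_mono) auto
      qed
    qed measurable
    from integral_symmetric_pair(2)[OF this] show ?thesis
      by (simp add: set_lebesgue_integral_def scaleR_diff_right)
  qed
  have "((\<lambda>y. LBINT t. indicator {0<..} t *\<^sub>R ((t / (t\<^sup>2 + y\<^sup>2)) *\<^sub>R (f (x + t) - f (x - t)))) \<longlongrightarrow>
      (LBINT t. indicator {0<..} t *\<^sub>R ((f (x + t) - f (x - t)) /\<^sub>R t))) (at_right 0)"
  proof (rule integral_dominated_convergence_within[where w = ?w])
    show "integrable lborel ?w" by (rule w)
    show "AE t in lborel. ((\<lambda>y. indicator {0<..} t *\<^sub>R ((t / (t\<^sup>2 + y\<^sup>2)) *\<^sub>R (f (x + t) - f (x - t)))) \<longlongrightarrow>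
        indicator {0<..} t *\<^sub>R ((f (x + t) - f (x - t)) /\<^sub>R t)) (at_right 0)"
    proof (rule AE_I2)
      fix t
      show "((\<lambda>y. indicator {0<..} t *\<^sub>R ((t / (t\<^sup>2 + y\<^sup>2)) *\<^sub>R (f (x + t) - f (x - t)))) \<longlongrightarrow>
        indicator {0<..} t *\<^sub>R ((f (x + t) - f (x - t)) /\<^sub>R t)) (at_right 0)"
      proof (cases "t > 0")
        case True
        have "((\<lambda>y. t / (t\<^sup>2 + y\<^sup>2)) \<longlongrightarrow> t / (t\<^sup>2 + 0\<^sup>2)) (at_right 0)"
          using True by (intro tendsto_intros) auto
        moreover have "t / (t\<^sup>2 + 0\<^sup>2) = inverse t"
          using True by (simp add: power2_eq_square field_simps)
        ultimately show ?thesis by (intro tendsto_intros) simp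
      qed simp
    qed
    show "norm (indicator {0<..} t *\<^sub>R ((t / (t\<^sup>2 + y\<^sup>2)) *\<^sub>R (f (x + t) - f (x - t)))) \<le> ?w t"
      if "y \<in> {0<..} - {0}" for y t
    proof (cases "t > 0")
      case True
      have "t / (t\<^sup>2 + y\<^sup>2) \<le> inverse t"
      proof -
        have "t / (t\<^sup>2 + y\<^sup>2) \<le> t / t\<^sup>2"
          using True by (intro divide_left_mono) (auto intro!: mult_pos_pos add_pos_nonneg)
        then show ?thesis using True by (simp add: power2_eq_square inverse_eq_divide)
      qed
      then have "norm ((t / (t\<^sup>2 + y\<^sup>2)) *\<^sub>R (f (x + t) - f (x - t))) \<le> norm ((f (x + t) - f (x - t)) /\<^sub>R t)"
        unfolding norm_scaleR using True by (intro mult_right_mono) auto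
      with bd[OF True] True show ?thesis by simp
    qed (use L0 in auto)
  qed measurable
  then show "((\<lambda>y. LBINT t. (t / (t\<^sup>2 + y\<^sup>2)) *\<^sub>R f (x + t)) \<longlongrightarrow> pv_integral x ?g) (at_right 0)"
    unfolding pv by (rule Lim_transform_eventually) (use q in \<open>auto intro!: eventually_at_rightI[of 0 1]\<close>)
qed


section \<open>Moving the hypersingular operator onto the conjugate Poisson kernel\<close>

text \<open>For each fixed s the second difference is symmetric under the pairing, by translation
  invariance. Fubini is needed on both sides: for F it rests on the decay of u, for G on Q being
  bounded and Lipschitz, so that its second differences are O(min(1,|s|)).\<close>

lemma hypersingular_transpose:
  fixes Q :: "real \<Rightarrow> real"
  assumes a: "0 < a" "a < 1" and u: "schwartz u"
    and Q[measurable]: "Q \<in> borel_measurable borel" and QB: "\<And>t. \<bar>Q t\<bar> \<le> B"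
    and QL: "\<And>t s. \<bar>Q (t + s) - Q t\<bar> \<le> B * \<bar>s\<bar>"
  shows "(LBINT t. Q t *\<^sub>R hypersingular a u (x + t)) = (LBINT t. hypersingular a Q t *\<^sub>R u (x + t))"
    and "integrable lborel (\<lambda>t. hypersingular a Q t *\<^sub>R u (x + t))"
proof -
  have [measurable]: "u \<in> borel_measurable borel"
    by (rule borel_measurable_continuous_onI[OF schwartz_continuous[OF u]])
  note ui = schwartz_integrable[OF u]
  have uix: "integrable lborel (\<lambda>t. u (x + t))" by (rule integrable_translation(3)[OF ui])
  have B0: "B \<ge> 0" using QB[of 0] by linarith
  have sdQ: "\<bar>second_difference Q s t\<bar> \<le> 4 * B * min 1 \<bar>s\<bar>" for s t
  proof -
    have "\<bar>Q (t + s) - Q t\<bar> \<le> 2 * B * min 1 \<bar>s\<bar>" for t s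
    proof (cases "\<bar>s\<bar> \<le> 1")
      case True
      then show ?thesis using QL[of t s] mult_nonneg_nonneg[OF B0 abs_ge_zero[of s]] by (simp add: min_absorb2)
    next
      case False
      then show ?thesis using QB[of t] QB[of "t + s"] by simp
    qed
    then show ?thesis using second_difference_uniform_bound[of Q "2 * B" s t] by simp
  qed
  have mult_int: "integrable lborel (\<lambda>t. b t *\<^sub>R f t)"
    if "integrable lborel f" "b \<in> borel_measurable borel" "\<And>t. \<bar>b t\<bar> \<le> M" for f :: "real \<Rightarrow> complex" and b M
  proof (rule Bochner_Integration.integrable_bound)
    have [measurable]: "f \<in> borel_measurable borel" using borel_measurable_integrable[OF that(1)] by simp
    note that(2)[measurable]
    show "integrable lborel (\<lambda>t. M *\<^sub>R f t)" using that(1) by simp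
    show "(\<lambda>t. b t *\<^sub>R f t) \<in> borel_measurable lborel" by measurable
    show "AE t in lborel. norm (b t *\<^sub>R f t) \<le> norm (M *\<^sub>R f t)"
      unfolding norm_scaleR using that(3) by (intro AE_I2 mult_right_mono) (auto intro: order_trans[OF _ abs_ge_self])
  qed
  let ?F = "\<lambda>s t. indicator {0<..} s *\<^sub>R (Q t *\<^sub>R (second_difference u s (x + t) /\<^sub>R s powr (1 + a)))"
  let ?G = "\<lambda>s t. indicator {0<..} s *\<^sub>R ((second_difference Q s t *\<^sub>R u (x + t)) /\<^sub>R s powr (1 + a))"
  have F: "integrable (lborel \<Otimes>\<^sub>M lborel) (case_prod ?F)"
  proof -
    \<comment> \<open>Stated with t in place of x + t, to fit the pair lemma; the translation is
      restored below, where it leaves the integrals over t unchanged.\<close>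
    have 1: "integrable (lborel \<Otimes>\<^sub>M lborel)
      (\<lambda>(s, t). indicator {0<..} s *\<^sub>R (Q (t - x) *\<^sub>R (second_difference u s t /\<^sub>R s powr (1 + a))))"
      by (rule schwartz_hypersingular_pair_integrable[OF a u, where B = B]) (use QB in auto)
    show ?thesis
    proof (rule lborel_pair.Fubini_integrable)
      show "case_prod ?F \<in> borel_measurable (lborel \<Otimes>\<^sub>M lborel)"
        unfolding second_difference_def by measurable
      have 2: "(LBINT t. norm (case_prod ?F (s, t))) =
         (LBINT t. norm (indicator {0<..} s *\<^sub>R (Q (t - x) *\<^sub>R (second_difference u s t /\<^sub>R s powr (1 + a)))))" for s
        by (subst (2) integral_translation(3)[of _ x, symmetric]) simp
      show "integrable lborel (\<lambda>s. LBINT t. norm (case_prod ?F (s, t)))"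
        unfolding 2 using lborel_pair.integrable_fst'[OF integrable_norm[OF 1]] by (simp add: case_prod_unfold)
      show "AE s in lborel. integrable lborel (\<lambda>t. case_prod ?F (s, t))"
        using lborel_pair.AE_integrable_fst'[OF 1]
      proof eventually_elim
        case (elim s)
        then show ?case using integrable_translation(3)[of _ x] by fastforce
      qed
    qed
  qed
  have G: "integrable (lborel \<Otimes>\<^sub>M lborel) (case_prod ?G)"
  proof (rule integrable_pair_dominated[where k = "truncated_weight a" and
        g = "\<lambda>s t. 4 * B * norm (u (x + t))"])
    show "integrable lborel (truncated_weight a)" by (rule integrable_truncated_weight[OF a])
    show "integrable lborel (\<lambda>t. 4 * B * norm (u (x + t)))" using uix by simp
    show "(LBINT t. 4 * B * norm (u (x + t))) \<le> (LBINT t. 4 * B * norm (u (x + t)))" by simp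
    show "norm (case_prod ?G (s, t)) \<le> truncated_weight a s * (4 * B * norm (u (x + t)))" for s t
    proof -
      have "norm (?G s t) \<le> 4 * B * norm (u (x + t)) * truncated_weight a s"
      proof (rule weighted_bound)
        assume "s > 0"
        then have "\<bar>second_difference Q s t\<bar> * norm (u (x + t)) \<le> 4 * B * min 1 s * norm (u (x + t))"
          using sdQ[of s t] by (intro mult_right_mono) auto
        then show "norm (second_difference Q s t *\<^sub>R u (x + t)) \<le> 4 * B * norm (u (x + t)) * min 1 s"
          by (simp add: mult_ac)
      qed
      then show ?thesis by (simp add: mult_ac)
    qed
    show "case_prod ?G \<in> borel_measurable (lborel \<Otimes>\<^sub>M lborel)"
      unfolding second_difference_def by measurable
  qed (rule truncated_weight_nonneg)
  have shift: "(LBINT t. Q t *\<^sub>R second_difference u s (x + t)) = (LBINT t. second_difference Q s t *\<^sub>R u (x + t))" for s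
  proof -
    have s1: "(LBINT t. Q t *\<^sub>R u (x + t + r)) = (LBINT t. Q (t - r) *\<^sub>R u (x + t))" for r
      using integral_translation(1)[of "\<lambda>t. Q (t - r) *\<^sub>R u (x + t)" r] by (simp add: add.assoc)
    have i1: "integrable lborel (\<lambda>t. Q t *\<^sub>R u (x + t + r))" for r
      by (rule mult_int[OF _ _ QB]) (use integrable_translation(3)[OF ui, of "x + r"] in \<open>auto simp: add_ac\<close>)
    have i2: "integrable lborel (\<lambda>t. Q (t - r) *\<^sub>R u (x + t))" for r
      by (rule mult_int[OF uix _ QB]) auto
    have "(LBINT t. Q t *\<^sub>R second_difference u s (x + t)) =
      (LBINT t. (Q t *\<^sub>R u (x + t + s) + Q t *\<^sub>R u (x + t + - s)) - 2 *\<^sub>R (Q t *\<^sub>R u (x + t + 0)))"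
      by (simp add: second_difference_def scaleR_diff_right scaleR_add_right mult.commute)
    also have "\<dots> = ((LBINT t. Q t *\<^sub>R u (x + t + s)) + (LBINT t. Q t *\<^sub>R u (x + t + - s)))
        - 2 *\<^sub>R (LBINT t. Q t *\<^sub>R u (x + t + 0))"
      using i1 by (simp only: Bochner_Integration.integral_diff Bochner_Integration.integral_add
          Bochner_Integration.integrable_add integrable_scaleR_right integral_scaleR_right)
    also have "\<dots> = ((LBINT t. Q (t - s) *\<^sub>R u (x + t)) + (LBINT t. Q (t - - s) *\<^sub>R u (x + t)))
        - 2 *\<^sub>R (LBINT t. Q (t - 0) *\<^sub>R u (x + t))"
      unfolding s1 ..
    also have "\<dots> = (LBINT t. (Q (t - s) *\<^sub>R u (x + t) + Q (t - - s) *\<^sub>R u (x + t)) - 2 *\<^sub>R (Q (t - 0) *\<^sub>R u (x + t)))"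
      using i2 by (simp only: Bochner_Integration.integral_diff Bochner_Integration.integral_add
          Bochner_Integration.integrable_add integrable_scaleR_right integral_scaleR_right)
    also have "\<dots> = (LBINT t. second_difference Q s t *\<^sub>R u (x + t))"
      by (simp add: second_difference_def scaleR_diff_left scaleR_add_left add.commute)
    finally show ?thesis .
  qed
  have inner: "(LBINT t. ?F s t) = (LBINT t. ?G s t)" for s
  proof -
    have "(LBINT t. ?F s t) = (LBINT t. (indicator {0<..} s * inverse (s powr (1 + a))) *\<^sub>R
        (Q t *\<^sub>R second_difference u s (x + t)))"
      by (simp add: mult_ac)
    also have "\<dots> = (LBINT t. (indicator {0<..} s * inverse (s powr (1 + a))) *\<^sub>R
        (second_difference Q s t *\<^sub>R u (x + t)))"
      by (subst (1 2) integral_scaleR_right) (simp only: shift)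
    also have "\<dots> = (LBINT t. ?G s t)" by (simp add: mult_ac)
    finally show ?thesis .
  qed
  have Fs: "(LBINT s. ?F s t) = Q t *\<^sub>R hypersingular a u (x + t)" for t
  proof -
    have "(LBINT s. ?F s t) = (LBINT s. Q t *\<^sub>R (indicator {0<..} s *\<^sub>R (second_difference u s (x + t) /\<^sub>R s powr (1 + a))))"
      by (simp add: mult_ac)
    then show ?thesis
      by (simp only: integral_scaleR_right hypersingular_def set_lebesgue_integral_def)
  qed
  have Gs: "(LBINT s. ?G s t) = hypersingular a Q t *\<^sub>R u (x + t)" for t
  proof -
    have i: "integrable lborel (\<lambda>s. indicator {0<..} s *\<^sub>R (second_difference Q s t /\<^sub>R s powr (1 + a)))"
      unfolding set_integrable_def[symmetric]
    proof (rule weighted_set_integrable[OF a])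
      show "norm (second_difference Q s t) \<le> 4 * B * min 1 s" if "s > 0" for s
        using sdQ[of s t] that by simp
    qed (simp add: second_difference_def)
    have "(LBINT s. ?G s t) = (LBINT s. (indicator {0<..} s *\<^sub>R (second_difference Q s t /\<^sub>R s powr (1 + a))) *\<^sub>R u (x + t))"
      by (simp add: mult_ac)
    also have "\<dots> = (LBINT s. indicator {0<..} s *\<^sub>R (second_difference Q s t /\<^sub>R s powr (1 + a))) *\<^sub>R u (x + t)"
      by (rule integral_scaleR_left) (use i in simp)
    finally show ?thesis by (simp add: hypersingular_def set_lebesgue_integral_def)
  qed
  have "(LBINT t. Q t *\<^sub>R hypersingular a u (x + t)) = (LBINT t. LBINT s. ?F s t)"
    unfolding Fs ..
  also have "\<dots> = (LBINT s. LBINT t. ?F s t)" by (rule lborel_pair.Fubini_integral[OF F])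
  also have "\<dots> = (LBINT s. LBINT t. ?G s t)" unfolding inner ..
  also have "\<dots> = (LBINT t. LBINT s. ?G s t)" by (rule lborel_pair.Fubini_integral[OF G, symmetric])
  finally show "(LBINT t. Q t *\<^sub>R hypersingular a u (x + t)) = (LBINT t. hypersingular a Q t *\<^sub>R u (x + t))"
    unfolding Gs .
  show "integrable lborel (\<lambda>t. hypersingular a Q t *\<^sub>R u (x + t))"
    using lborel_pair.integrable_snd[OF G] unfolding Gs .
qed

text \<open>Taken without the customary factor 1/pi, which \<open>hilbert\<close> carries
  separately.\<close>

definition conjugate_poisson :: "real \<Rightarrow> real \<Rightarrow> real" where
  "conjugate_poisson y t = t / (t\<^sup>2 + y\<^sup>2)"

lemma conjugate_poisson_Re: "conjugate_poisson y t = Re (1 / Complex t y)"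
  by (simp add: conjugate_poisson_def Re_divide power2_eq_square)

text \<open>From |t + iy| >= y the kernel is at most 1/y and its Lipschitz constant at most 1/y^2.
  Their sum is used because the transposition takes one constant for both; it serves only at fixed
  y.\<close>

lemma conjugate_poisson_bounds:
  assumes "y > 0"
  shows "\<bar>conjugate_poisson y t\<bar> \<le> 1 / y + 1 / y\<^sup>2"
    and "\<bar>conjugate_poisson y (t + s) - conjugate_poisson y t\<bar> \<le> (1 / y + 1 / y\<^sup>2) * \<bar>s\<bar>"
proof -
  have n: "y \<le> cmod (Complex t y)" for t
    using abs_Im_le_cmod[of "Complex t y"] assms by simp
  have nz: "Complex t y \<noteq> 0" for t using n[of t] assms by (metis norm_zero not_less)
  have frac_diff: "1 / p - 1 / q = (q - p) / (p * q)" if "p \<noteq> 0" "q \<noteq> 0" for p q :: complex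
    using that by (simp add: field_simps)
  have "\<bar>conjugate_poisson y t\<bar> \<le> cmod (1 / Complex t y)"
    unfolding conjugate_poisson_Re by (rule abs_Re_le_cmod)
  also have "\<dots> = 1 / cmod (Complex t y)" by (simp add: norm_divide)
  also have "\<dots> \<le> 1 / y" using n[of t] assms by (intro divide_left_mono) (auto intro: mult_pos_pos less_le_trans)
  finally show "\<bar>conjugate_poisson y t\<bar> \<le> 1 / y + 1 / y\<^sup>2" using assms by (smt (verit) zero_le_divide_1_iff zero_le_power2)
  have "\<bar>conjugate_poisson y (t + s) - conjugate_poisson y t\<bar> =
      \<bar>Re (1 / Complex (t + s) y - 1 / Complex t y)\<bar>"
    by (simp add: conjugate_poisson_Re)
  also have "\<dots> \<le> cmod (1 / Complex (t + s) y - 1 / Complex t y)" by (rule abs_Re_le_cmod)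
  also have "1 / Complex (t + s) y - 1 / Complex t y = (Complex t y - Complex (t + s) y) / (Complex (t + s) y * Complex t y)"
    using nz[of t] nz[of "t + s"] frac_diff by blast
  also have "Complex t y - Complex (t + s) y = of_real (- s)" by (simp add: complex_eq_iff)
  also have "cmod (of_real (- s) / (Complex (t + s) y * Complex t y)) = \<bar>s\<bar> / (cmod (Complex (t + s) y) * cmod (Complex t y))"
    by (simp add: norm_divide norm_mult)
  also have "\<dots> \<le> \<bar>s\<bar> / (y * y)"
    using n[of t] n[of "t + s"] assms
    by (intro divide_left_mono mult_mono mult_pos_pos) (auto intro: less_le_trans)
  also have "\<dots> = 1 / y\<^sup>2 * \<bar>s\<bar>" by (simp add: power2_eq_square)
  also have "\<dots> \<le> (1 / y + 1 / y\<^sup>2) * \<bar>s\<bar>"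
    using assms by (intro mult_right_mono) auto
  finally show "\<bar>conjugate_poisson y (t + s) - conjugate_poisson y t\<bar> \<le> (1 / y + 1 / y\<^sup>2) * \<bar>s\<bar>" .
qed

lemma hypersingular_conjugate_poisson:
  assumes a: "0 < a" "a < 1" and "y > 0"
  shows "hypersingular a (conjugate_poisson y) t =
    Re (- of_real (Gamma a * Gamma (1 - a)) * Complex t y powr (- 1 - of_real a) * (1 + exp (\<i> * of_real (pi * a))))"
proof -
  have "hypersingular a (conjugate_poisson y) t =
      (LBINT s. Re (indicator {0<..} s *\<^sub>R
        ((1 / (Complex t y + of_real s) + 1 / (Complex t y - of_real s) - 2 / Complex t y) /\<^sub>R s powr (1 + a))))"
    unfolding hypersingular_def set_lebesgue_integral_def
  proof (rule Bochner_Integration.integral_cong[OF refl])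
    fix s
    have "Complex t y + of_real s = Complex (t + s) y" "Complex t y - of_real s = Complex (t - s) y"
      by (simp_all add: complex_eq_iff)
    moreover have "2 / Complex t y = 2 *\<^sub>R (1 / Complex t y)" by (simp add: scaleR_conv_of_real)
    ultimately show "indicator {0<..} s *\<^sub>R (second_difference (conjugate_poisson y) s t /\<^sub>R s powr (1 + a)) =
      Re (indicator {0<..} s *\<^sub>R
        ((1 / (Complex t y + of_real s) + 1 / (Complex t y - of_real s) - 2 / Complex t y) /\<^sub>R s powr (1 + a)))"
      unfolding second_difference_def conjugate_poisson_Re
      by (simp only: scaleR_complex.sel plus_complex.sel minus_complex.sel real_scaleR_def)
  qed
  also have "\<dots> = Re (LBINT s. indicator {0<..} s *\<^sub>R
        ((1 / (Complex t y + of_real s) + 1 / (Complex t y - of_real s) - 2 / Complex t y) /\<^sub>R s powr (1 + a)))"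
    by (rule integral_Re) (use two_sided_kernel(1)[OF a, of "Complex t y"] assms in \<open>simp add: set_integrable_def\<close>)
  also have "\<dots> = Re (- of_real (Gamma a * Gamma (1 - a)) * Complex t y powr (- 1 - of_real a) * (1 + exp (\<i> * of_real (pi * a))))"
    using two_sided_kernel(2)[OF a, of "Complex t y"] assms by (simp add: set_lebesgue_integral_def)
  finally show ?thesis .
qed

text \<open>Parity disposes of negative t, where t + iy approaches the branch cut of the power as y
  -> 0.\<close>

lemma hypersingular_conjugate_poisson_odd:
  "hypersingular a (conjugate_poisson y) (- t) = - hypersingular a (conjugate_poisson y) t"
proof -
  have odd: "conjugate_poisson y (- r) = - conjugate_poisson y r" for r
    by (simp add: conjugate_poisson_def)
  have "second_difference (conjugate_poisson y) s (- t) = - second_difference (conjugate_poisson y) s t" for s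
  proof -
    have "- t + s = - (t - s)" "- t - s = - (t + s)" by simp_all
    then show ?thesis unfolding second_difference_def by (simp only: odd) simp
  qed
  then show ?thesis by (simp add: hypersingular_def set_lebesgue_integral_def)
qed

text \<open>Uniform in y, unlike the bounds on the kernel itself: |t + iy| >= t and the exponent is
  negative. The 2 bounds |1 + e^(i pi a)|.\<close>

lemma hypersingular_conjugate_poisson_bound:
  assumes a: "0 < a" "a < 1" and "y > 0" "t > 0"
  shows "\<bar>hypersingular a (conjugate_poisson y) t\<bar> \<le> 2 * (Gamma a * Gamma (1 - a)) / t powr (1 + a)"
proof -
  have K: "Gamma a * Gamma (1 - a) > 0" using a by (intro mult_pos_pos Gamma_real_pos) auto
  have nz: "Complex t y \<noteq> 0" using assms by (simp add: complex_eq_iff)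
  have le: "t \<le> cmod (Complex t y)" using abs_Re_le_cmod[of "Complex t y"] assms by simp
  have "cmod (Complex t y powr (- 1 - of_real a)) = cmod (Complex t y) powr (- (1 + a))"
    using nz by (subst norm_powr_real_powr') (auto simp: algebra_simps)
  also have "\<dots> \<le> t powr (- (1 + a))"
    using le assms by (intro powr_mono2') auto
  also have "\<dots> = 1 / t powr (1 + a)" by (simp only: powr_minus_divide)
  finally have 1: "cmod (Complex t y powr (- 1 - of_real a)) \<le> 1 / t powr (1 + a)" .
  have 2: "cmod (1 + exp (\<i> * of_real (pi * a))) \<le> 2"
    using norm_triangle_ineq[of 1 "exp (\<i> * of_real (pi * a))"] by simp
  have "\<bar>hypersingular a (conjugate_poisson y) t\<bar> \<le>
     cmod (- of_real (Gamma a * Gamma (1 - a)) * Complex t y powr (- 1 - of_real a) * (1 + exp (\<i> * of_real (pi * a))))"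
    unfolding hypersingular_conjugate_poisson[OF assms(1-3)] by (rule abs_Re_le_cmod)
  also have "\<dots> = Gamma a * Gamma (1 - a) * cmod (Complex t y powr (- 1 - of_real a)) * cmod (1 + exp (\<i> * of_real (pi * a)))"
    using Gamma_real_pos[of a] Gamma_real_pos[of "1 - a"] a by (simp add: norm_mult)
  also have "\<dots> \<le> Gamma a * Gamma (1 - a) * (1 / t powr (1 + a)) * 2"
    using K by (intro mult_mono 1 2 mult_left_mono) auto
  finally show ?thesis by (simp add: mult_ac)
qed

lemma hypersingular_conjugate_poisson_tendsto:
  assumes a: "0 < a" "a < 1" and "t > 0"
  shows "((\<lambda>y. hypersingular a (conjugate_poisson y) t) \<longlongrightarrow>
    - (Gamma a * Gamma (1 - a)) * (1 + cos (pi * a)) / t powr (1 + a)) (at_right 0)"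
proof -
  let ?V = "\<lambda>y. Re (- of_real (Gamma a * Gamma (1 - a)) * Complex t y powr (- 1 - of_real a) * (1 + exp (\<i> * of_real (pi * a))))"
  have "((\<lambda>y. Complex t y powr (- 1 - of_real a)) \<longlongrightarrow> Complex t 0 powr (- 1 - of_real a)) (at_right 0)"
    using assms by (intro tendsto_powr_complex tendsto_Complex tendsto_intros) (auto simp: complex_nonpos_Reals_iff)
  then have "(?V \<longlongrightarrow> ?V 0) (at_right 0)"
    by (intro tendsto_Re tendsto_mult_left tendsto_mult_right)
  moreover have "?V 0 = - (Gamma a * Gamma (1 - a)) * (1 + cos (pi * a)) / t powr (1 + a)"
  proof -
    have "Complex t 0 = of_real t" "- 1 - complex_of_real a = of_real (- 1 - a)"
      by (simp_all add: complex_eq_iff)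
    then have "Complex t 0 powr (- 1 - of_real a) = of_real t powr of_real (- 1 - a)"
      by (simp only:)
    also have "\<dots> = of_real (t powr (- 1 - a))" using assms by (intro powr_of_real) auto
    also have "t powr (- 1 - a) = 1 / t powr (1 + a)"
      using powr_minus_divide[of t "1 + a"] by (simp add: algebra_simps)
    finally have e: "Complex t 0 powr (- 1 - of_real a) = of_real (1 / t powr (1 + a))" .
    have "- of_real (Gamma a * Gamma (1 - a)) * Complex t 0 powr (- 1 - of_real a) =
       complex_of_real (- (Gamma a * Gamma (1 - a)) * (1 / t powr (1 + a)))"
      unfolding e by simp
    then have "?V 0 = - (Gamma a * Gamma (1 - a)) * (1 / t powr (1 + a)) * Re (1 + exp (\<i> * of_real (pi * a)))"
      by (simp only: Re_complex_of_real times_complex.sel Im_complex_of_real)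
    also have "Re (1 + exp (\<i> * of_real (pi * a))) = 1 + cos (pi * a)"
      by (simp add: Re_exp)
    finally show ?thesis by simp
  qed
  ultimately have "(?V \<longlongrightarrow> - (Gamma a * Gamma (1 - a)) * (1 + cos (pi * a)) / t powr (1 + a)) (at_right 0)"
    by simp
  then show ?thesis
    by (rule Lim_transform_eventually)
       (use hypersingular_conjugate_poisson[OF a] in \<open>auto intro!: eventually_at_rightI[of 0 1]\<close>)
qed

text \<open>The regularised integrals have two limits as y -> 0. On the side of L u the limit is the
  principal value; on the side of L Q_y, folding by oddness gives the integrand of H_{-alpha}, where
  the increment of u makes the singular bound on the kernel integrable.\<close>

lemma hilbert_hypersingular:
  assumes a: "0 < a" "a < 1" and u: "schwartz u"
  shows "pv_converges x (\<lambda>t. hypersingular a u t /\<^sub>R (t - x))"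
    and "pv_integral x (\<lambda>t. hypersingular a u t /\<^sub>R (t - x)) =
      (- (Gamma a * Gamma (1 - a)) * (1 + cos (pi * a))) *\<^sub>R
        (LBINT t:{0<..}. (u (x + t) - u (x - t)) /\<^sub>R t powr (1 + a))"
proof -
  let ?K = "Gamma a * Gamma (1 - a)" and ?H = "\<lambda>y. hypersingular a (conjugate_poisson y)"
  have K: "?K > 0" using a by (intro mult_pos_pos Gamma_real_pos) auto
  have [measurable]: "u \<in> borel_measurable borel"
    by (rule borel_measurable_continuous_onI[OF schwartz_continuous[OF u]])
  obtain C where C: "C > 0"
    "\<And>x s. cmod (u (x + s) - u x) \<le> C * min 1 \<bar>s\<bar> * (1 / (1 + x\<^sup>2) + 1 / (1 + (x + s)\<^sup>2))"
    using schwartz_increments[OF u] by metis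
  have inc: "cmod (u (x + t) - u (x - t)) \<le> 4 * C * min 1 t" if "t > 0" for t
    using norm_triangle_ineq4[of "u (x + t) - u x" "u (x + - t) - u x"]
      schwartz_increment_uniform_bound[OF C, of x t] schwartz_increment_uniform_bound[OF C, of x "- t"] that
    by simp
  obtain L where L: "\<And>x y. cmod (hypersingular a u x - hypersingular a u y) \<le> L * \<bar>x - y\<bar>"
    using schwartz_hypersingular_lipschitz[OF assms] by blast
  note hpv = hilbert_pv_lipschitz[OF schwartz_hypersingular_integrable[OF assms] L, of x]
  show "pv_converges x (\<lambda>t. hypersingular a u t /\<^sub>R (t - x))" by (rule hpv(1))
  have [measurable]: "conjugate_poisson y \<in> borel_measurable borel" for y
    unfolding conjugate_poisson_def[abs_def] by measurable
  have eq: "(LBINT t. (t / (t\<^sup>2 + y\<^sup>2)) *\<^sub>R hypersingular a u (x + t)) =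
      (LBINT t. indicator {0<..} t *\<^sub>R (?H y t *\<^sub>R (u (x + t) - u (x - t))))" if "y > 0" for y
  proof -
    note tr = hypersingular_transpose[OF assms, of "conjugate_poisson y" "1 / y + 1 / y\<^sup>2" x,
        OF _ conjugate_poisson_bounds[OF that]]
    have "(LBINT t. (t / (t\<^sup>2 + y\<^sup>2)) *\<^sub>R hypersingular a u (x + t)) = (LBINT t. ?H y t *\<^sub>R u (x + t))"
      using tr(1) by (simp add: conjugate_poisson_def)
    also have "\<dots> = (LBINT t:{0<..}. ?H y t *\<^sub>R u (x + t) + ?H y (- t) *\<^sub>R u (x + - t))"
      by (rule integral_symmetric_pair(2)[OF tr(2)]) simp
    finally show ?thesis
      by (simp add: hypersingular_conjugate_poisson_odd scaleR_diff_right set_lebesgue_integral_def)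
  qed
  have meas: "(\<lambda>t. hypersingular a (conjugate_poisson y) t) \<in> borel_measurable lborel" for y
    unfolding hypersingular_def set_lebesgue_integral_def second_difference_def by measurable
  have lim: "((\<lambda>y. LBINT t. indicator {0<..} t *\<^sub>R (?H y t *\<^sub>R (u (x + t) - u (x - t)))) \<longlongrightarrow>
      (LBINT t. indicator {0<..} t *\<^sub>R ((- ?K * (1 + cos (pi * a)) / t powr (1 + a)) *\<^sub>R (u (x + t) - u (x - t)))))
      (at_right 0)"
  proof (rule integral_dominated_convergence_within[where w = "\<lambda>t. 2 * ?K * (4 * C) * truncated_weight a t"])
    show "integrable lborel (\<lambda>t. 2 * ?K * (4 * C) * truncated_weight a t)"
      by (intro integrable_mult_right integrable_truncated_weight a)
    show "(\<lambda>t. indicator {0<..} t *\<^sub>R (?H y t *\<^sub>R (u (x + t) - u (x - t)))) \<in> borel_measurable lborel" for y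
      using meas[of y] by measurable
    show "AE t in lborel. ((\<lambda>y. indicator {0<..} t *\<^sub>R (?H y t *\<^sub>R (u (x + t) - u (x - t)))) \<longlongrightarrow>
      indicator {0<..} t *\<^sub>R ((- ?K * (1 + cos (pi * a)) / t powr (1 + a)) *\<^sub>R (u (x + t) - u (x - t)))) (at_right 0)"
    proof (rule AE_I2)
      fix t
      show "((\<lambda>y. indicator {0<..} t *\<^sub>R (?H y t *\<^sub>R (u (x + t) - u (x - t)))) \<longlongrightarrow>
        indicator {0<..} t *\<^sub>R ((- ?K * (1 + cos (pi * a)) / t powr (1 + a)) *\<^sub>R (u (x + t) - u (x - t)))) (at_right 0)"
      proof (cases "t > 0")
        case True
        show ?thesis
          by (intro tendsto_scaleR tendsto_const hypersingular_conjugate_poisson_tendsto[OF a True])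
      qed simp
    qed
    fix y t :: real assume y: "y \<in> {0<..} - {0}"
    show "norm (indicator {0<..} t *\<^sub>R (?H y t *\<^sub>R (u (x + t) - u (x - t)))) \<le> 2 * ?K * (4 * C) * truncated_weight a t"
    proof (cases "t > 0")
      case True
      have "norm (?H y t *\<^sub>R (u (x + t) - u (x - t))) \<le> 2 * ?K / t powr (1 + a) * (4 * C * min 1 t)"
        unfolding norm_scaleR
        by (intro mult_mono hypersingular_conjugate_poisson_bound[OF a] inc) (use y True K in auto)
      then show ?thesis using True by (simp add: truncated_weight_def mult_ac)
    qed (simp add: truncated_weight_def)
  qed measurable
  have "((\<lambda>y. LBINT t. (t / (t\<^sup>2 + y\<^sup>2)) *\<^sub>R hypersingular a u (x + t)) \<longlongrightarrow>
      (LBINT t. indicator {0<..} t *\<^sub>R ((- ?K * (1 + cos (pi * a)) / t powr (1 + a)) *\<^sub>R (u (x + t) - u (x - t)))))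
      (at_right 0)"
    by (rule Lim_transform_eventually[OF lim]) (use eq in \<open>auto intro!: eventually_at_rightI[of 0 1]\<close>)
  from tendsto_unique[OF _ hpv(2) this]
  have "pv_integral x (\<lambda>t. hypersingular a u t /\<^sub>R (t - x)) =
     (LBINT t. indicator {0<..} t *\<^sub>R ((- ?K * (1 + cos (pi * a)) / t powr (1 + a)) *\<^sub>R (u (x + t) - u (x - t))))"
    by simp
  also have "\<dots> = (LBINT t. (- ?K * (1 + cos (pi * a))) *\<^sub>R (indicator {0<..} t *\<^sub>R ((u (x + t) - u (x - t)) /\<^sub>R t powr (1 + a))))"
    by (simp add: divide_inverse mult_ac)
  also have "\<dots> = (- ?K * (1 + cos (pi * a))) *\<^sub>R (LBINT t:{0<..}. (u (x + t) - u (x - t)) /\<^sub>R t powr (1 + a))"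
    by (simp only: integral_scaleR_right set_lebesgue_integral_def)
  finally show "pv_integral x (\<lambda>t. hypersingular a u t /\<^sub>R (t - x)) =
      (- ?K * (1 + cos (pi * a))) *\<^sub>R (LBINT t:{0<..}. (u (x + t) - u (x - t)) /\<^sub>R t powr (1 + a))" .
qed


section \<open>The heat semigroup and subordination in time\<close>

text \<open>The inversion r = 1/t of the scaled Gamma integral, with Jacobian 1/t^2. In this form
  the Gaussian can be integrated over time, since its exponent is a multiple of 1/t.\<close>

lemma has_bochner_integral_inverse_Gamma_scaled:
  fixes b p :: real
  assumes "b > 0" "p > 0"
  shows "has_bochner_integral lborel (\<lambda>t. indicator {0<..} t * (t powr (- 1 - b) * exp (- (p / t))))
    (Gamma b / p powr b)"
proof -
  let ?f = "\<lambda>r::real. r powr (b - 1) * exp (- (p * r))"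
  let ?g = "\<lambda>t::real. t powr (- 1 - b) * exp (- (p / t))"
  have f: "set_integrable lborel {0<..} ?f" "(LBINT r:{0<..}. ?f r) = Gamma b / p powr b"
    using has_bochner_integral_Gamma_scaled[OF assms]
    by (auto simp: has_bochner_integral_iff set_integrable_def set_lebesgue_integral_def)
  have img: "inverse ` {0<..} = {(0::real)<..}"
  proof (intro equalityI subsetI)
    show "x \<in> inverse ` {0<..}" if "x \<in> {0<..}" for x :: real
      by (rule image_eqI[of _ _ "inverse x"]) (use that in auto)
  qed auto
  have "?f absolutely_integrable_on {0<..}"
    using f(1) unfolding set_integrable_def by (subst integrable_completion) auto
  moreover have "integral {0<..} ?f = Gamma b / p powr b"
    using set_borel_integral_eq_integral(2)[OF f(1)] f(2) by simp
  ultimately have "?f absolutely_integrable_on (inverse ` {0<..}) \<and> integral (inverse ` {0<..}) ?f = Gamma b / p powr b"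
    unfolding img by simp
  then have "(\<lambda>t. \<bar>- inverse (t\<^sup>2)\<bar> * ?f (inverse t)) absolutely_integrable_on {0<..} \<and>
      integral {0<..} (\<lambda>t. \<bar>- inverse (t\<^sup>2)\<bar> * ?f (inverse t)) = Gamma b / p powr b"
    by (subst has_absolute_integral_change_of_variables_1')
       (auto intro!: derivative_eq_intros simp: power2_eq_square inj_on_def)
  moreover have eq: "\<bar>- inverse (t\<^sup>2)\<bar> * ?f (inverse t) = ?g t" if "t \<in> {0<..}" for t
  proof -
    have t: "t > 0" using that by simp
    have "inverse (t\<^sup>2) = t powr (- 2)" using t by (simp add: powr_minus powr_numeral)
    moreover have "inverse t powr (b - 1) = t powr (1 - b)"
      using t by (simp add: powr_minus[symmetric] inverse_powr)
    moreover have "t powr (- 2) * t powr (1 - b) = t powr (- 1 - b)"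
      by (simp add: powr_add[symmetric])
    ultimately show ?thesis by (simp add: divide_inverse mult.assoc[symmetric])
  qed
  moreover have "(\<lambda>t. \<bar>- inverse (t\<^sup>2)\<bar> * ?f (inverse t)) absolutely_integrable_on {0<..} \<longleftrightarrow>
      ?g absolutely_integrable_on {0<..}"
    by (rule set_integrable_cong[OF refl refl eq])
  moreover have "integral {0<..} (\<lambda>t. \<bar>- inverse (t\<^sup>2)\<bar> * ?f (inverse t)) = integral {0<..} ?g"
    by (rule Henstock_Kurzweil_Integration.integral_cong[OF eq])
  ultimately have g: "?g absolutely_integrable_on {0<..}" "integral {0<..} ?g = Gamma b / p powr b"
    by (simp_all only:)
  have "set_integrable lborel {0<..} ?g"
    using g(1) unfolding set_integrable_def by (subst (asm) integrable_completion) auto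
  then show ?thesis
    using set_borel_integral_eq_integral(2)[of "{0<..}" ?g] g(2)
    by (simp add: has_bochner_integral_iff set_integrable_def set_lebesgue_integral_def)
qed

lemma integrable_gaussian:
  fixes t :: real
  assumes "t > 0"
  shows "integrable lborel (\<lambda>\<xi>. exp (- (t * \<xi>\<^sup>2)))"
proof -
  \<comment> \<open>The standard deviation 1 / sqrt (2 t) is the one whose normal density has
    exponent -t \<xi>^2.\<close>
  have "exp (- (t * \<xi>\<^sup>2)) = sqrt (2 * pi * (1 / sqrt (2 * t))\<^sup>2) * normal_density 0 (1 / sqrt (2 * t)) \<xi>" for \<xi>
    using assms by (simp add: normal_density_def power_divide)
  then show ?thesis using assms by simp
qed

text \<open>Rescaling by r = sqrt (2 t) reduces the integral to the characteristic function of the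
  standard normal law; the same r reappears as the standard deviation of the heat kernel.\<close>

lemma fourier_gaussian:
  assumes "t > 0"
  shows "(LBINT \<xi>. of_real (exp (- (t * \<xi>\<^sup>2))) * exp (\<i> * of_real (\<xi> * z))) =
    complex_of_real (2 * pi * normal_density 0 (sqrt (2 * t)) z)"
proof -
  define r where "r = sqrt (2 * t)"
  have r: "r > 0" "r\<^sup>2 = 2 * t" using assms by (auto simp: r_def)
  have "(LBINT \<xi>. of_real (exp (- (t * \<xi>\<^sup>2))) * exp (\<i> * of_real (\<xi> * z))) =
      \<bar>1 / r\<bar> *\<^sub>R (LBINT x. complex_of_real (exp (- (t * (0 + 1 / r * x)\<^sup>2))) * exp (\<i> * of_real ((0 + 1 / r * x) * z)))"
    by (rule lborel_integral_real_affine) (use r in simp)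
  also have "(\<lambda>x. complex_of_real (exp (- (t * (0 + 1 / r * x)\<^sup>2))) * exp (\<i> * of_real ((0 + 1 / r * x) * z))) =
      (\<lambda>x. sqrt (2 * pi) *\<^sub>R (std_normal_density x *\<^sub>R iexp (z / r * x)))"
  proof
    fix x
    have "t * (0 + 1 / r * x)\<^sup>2 = x\<^sup>2 / 2"
      using r assms by (simp add: power_divide field_simps)
    then show "complex_of_real (exp (- (t * (0 + 1 / r * x)\<^sup>2))) * exp (\<i> * of_real ((0 + 1 / r * x) * z)) =
      sqrt (2 * pi) *\<^sub>R (std_normal_density x *\<^sub>R iexp (z / r * x))"
      by (simp add: std_normal_density_def scaleR_conv_of_real mult_ac)
  qed
  also have "(LBINT x. sqrt (2 * pi) *\<^sub>R (std_normal_density x *\<^sub>R iexp (z / r * x))) =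
      sqrt (2 * pi) *\<^sub>R char std_normal_distribution (z / r)"
  proof -
    have "char std_normal_distribution (z / r) = (LBINT x. std_normal_density x *\<^sub>R iexp (z / r * x))"
      unfolding char_def by (rule integral_density) auto
    then show ?thesis by (simp only: integral_scaleR_right)
  qed
  also have "\<dots> = of_real (sqrt (2 * pi) * exp (- ((z / r)\<^sup>2) / 2))"
    by (simp add: char_std_normal_distribution scaleR_conv_of_real)
  also have "\<bar>1 / r\<bar> *\<^sub>R complex_of_real (sqrt (2 * pi) * exp (- ((z / r)\<^sup>2) / 2)) =
      complex_of_real (2 * pi * normal_density 0 (sqrt (2 * t)) z)"
  proof -
    have "sqrt (2 * pi * r\<^sup>2) = sqrt (2 * pi) * r" by (subst real_sqrt_mult) (simp add: r(1) less_imp_le)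
    moreover have "2 * pi / sqrt (2 * pi) = sqrt (2 * pi)" by (rule real_div_sqrt) simp
    ultimately have "2 * pi * normal_density 0 r z = 1 / r * (sqrt (2 * pi) * exp (- ((z / r)\<^sup>2) / 2))"
      using r by (simp add: normal_density_def power_divide field_simps)
    then show ?thesis using r by (simp add: r_def scaleR_conv_of_real)
  qed
  finally show ?thesis .
qed

text \<open>The Gaussian multiplier makes the double integral over (\<xi>, y) absolutely convergent
  for any integrable u. Integrating over \<xi> first meets only the explicit Gaussian transform, so
  integrability of \<open>fourier u\<close> never enters.\<close>

lemma heat_eq_convolution:
  assumes u: "integrable lborel u" and t: "t > 0"
  shows "heat t u x = (LBINT s. normal_density 0 (sqrt (2 * t)) s *\<^sub>R u (x + s))"
    and "integrable lborel (\<lambda>\<xi>. of_real (exp (- (t * \<xi>\<^sup>2))) * fourier u \<xi>)"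
proof -
  have [measurable]: "u \<in> borel_measurable borel"
    using borel_measurable_integrable[OF u] by simp
  let ?f = "\<lambda>x \<xi> y. of_real (exp (- (t * \<xi>\<^sup>2))) * (u y * exp (- (\<i> * of_real (y * \<xi>)))) * exp (\<i> * of_real (x * \<xi>))"
  have f: "integrable (lborel \<Otimes>\<^sub>M lborel) (case_prod (?f x))" for x
  proof (rule integrable_pair_dominated[where k = "\<lambda>\<xi>. exp (- (t * \<xi>\<^sup>2))" and g = "\<lambda>\<xi> y. norm (u y)"])
    show "integrable lborel (\<lambda>\<xi>. exp (- (t * \<xi>\<^sup>2)))" by (rule integrable_gaussian[OF t])
    show "(LBINT y. norm (u y)) \<le> (LBINT y. norm (u y))" by simp
    show "norm (case (\<xi>, y) of (\<xi>, y) \<Rightarrow> ?f x \<xi> y) \<le> exp (- (t * \<xi>\<^sup>2)) * norm (u y)" for \<xi> y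
      by (simp add: norm_mult norm_exp)
    show "case_prod (?f x) \<in> borel_measurable (lborel \<Otimes>\<^sub>M lborel)" by measurable
  qed (use u in auto)
  have inner: "(LBINT y. ?f x \<xi> y) =
      of_real (exp (- (t * \<xi>\<^sup>2))) * (sqrt (2 * pi) *\<^sub>R fourier u \<xi>) * exp (\<i> * of_real (x * \<xi>))" for \<xi> x
    by (simp add: fourier_def del: of_real_mult of_real_exp)
  have "integrable lborel (\<lambda>\<xi>. (1 / sqrt (2 * pi)) *\<^sub>R
      (of_real (exp (- (t * \<xi>\<^sup>2))) * (sqrt (2 * pi) *\<^sub>R fourier u \<xi>) * exp (\<i> * of_real (0 * \<xi>))))"
    using lborel_pair.integrable_fst[OF f[of 0]] unfolding inner by (rule integrable_scaleR_right)
  then show "integrable lborel (\<lambda>\<xi>. of_real (exp (- (t * \<xi>\<^sup>2))) * fourier u \<xi>)"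
    by simp
  have outer: "(LBINT \<xi>. ?f x \<xi> y) = (2 * pi) *\<^sub>R (normal_density 0 (sqrt (2 * t)) (x - y) *\<^sub>R u y)" for y
  proof -
    have "?f x \<xi> y = u y * (of_real (exp (- (t * \<xi>\<^sup>2))) * exp (\<i> * of_real (\<xi> * (x - y))))" for \<xi>
    proof -
      have "exp (\<i> * of_real (\<xi> * (x - y))) = exp (- (\<i> * of_real (y * \<xi>))) * exp (\<i> * of_real (x * \<xi>))"
        by (simp add: algebra_simps flip: exp_add)
      then show ?thesis by (simp only: mult_ac)
    qed
    then have "(LBINT \<xi>. ?f x \<xi> y) = u y * (LBINT \<xi>. of_real (exp (- (t * \<xi>\<^sup>2))) * exp (\<i> * of_real (\<xi> * (x - y))))"
      by (simp only: integral_mult_right_zero)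
    also have "\<dots> = u y * complex_of_real (2 * pi * normal_density 0 (sqrt (2 * t)) (x - y))"
      by (simp only: fourier_gaussian[OF t])
    finally show ?thesis by (simp add: scaleR_conv_of_real)
  qed
  have "heat t u x = (1 / (2 * pi)) *\<^sub>R (LBINT \<xi>. LBINT y. ?f x \<xi> y)"
  proof -
    have "(LBINT \<xi>. LBINT y. ?f x \<xi> y) =
        (LBINT \<xi>. sqrt (2 * pi) *\<^sub>R (of_real (exp (- (t * \<xi>\<^sup>2))) * fourier u \<xi> * exp (\<i> * of_real (x * \<xi>))))"
      unfolding inner by simp
    also have "\<dots> = sqrt (2 * pi) *\<^sub>R (LBINT \<xi>. of_real (exp (- (t * \<xi>\<^sup>2))) * fourier u \<xi> * exp (\<i> * of_real (x * \<xi>)))"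
      by (rule integral_scaleR_right)
    finally have "(1 / (2 * pi)) *\<^sub>R (LBINT \<xi>. LBINT y. ?f x \<xi> y) = (1 / (2 * pi) * sqrt (2 * pi)) *\<^sub>R
        (LBINT \<xi>. of_real (exp (- (t * \<xi>\<^sup>2))) * fourier u \<xi> * exp (\<i> * of_real (x * \<xi>)))"
      by (simp only: scaleR_scaleR)
    moreover have "1 / (2 * pi) * sqrt (2 * pi) = 1 / sqrt (2 * pi)"
      using real_div_sqrt[of "2 * pi"] by (simp add: field_simps)
    ultimately show ?thesis by (simp only: heat_def)
  qed
  also have "(LBINT \<xi>. LBINT y. ?f x \<xi> y) = (LBINT y. LBINT \<xi>. ?f x \<xi> y)"
    by (rule lborel_pair.Fubini_integral[OF f, symmetric])
  also have "\<dots> = (2 * pi) *\<^sub>R (LBINT y. normal_density 0 (sqrt (2 * t)) (x - y) *\<^sub>R u y)"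
    unfolding outer by (rule integral_scaleR_right)
  also have "(1 / (2 * pi)) *\<^sub>R \<dots> = (LBINT y. normal_density 0 (sqrt (2 * t)) (x - y) *\<^sub>R u y)" by simp
  also have "\<dots> = (LBINT s. normal_density 0 (sqrt (2 * t)) (x - (x + s)) *\<^sub>R u (x + s))"
    by (rule integral_translation(3)[symmetric])
  also have "\<dots> = (LBINT s. normal_density 0 (sqrt (2 * t)) s *\<^sub>R u (x + s))"
    by (simp add: normal_density_def)
  finally show "heat t u x = (LBINT s. normal_density 0 (sqrt (2 * t)) s *\<^sub>R u (x + s))" .
qed

text \<open>The heat kernel has mass 1, so u x can be written under the same integral; evenness of
  the kernel then folds the increments into second differences.\<close>

lemma heat_increment:
  assumes u: "schwartz u" and t: "t > 0"
  shows "heat t u x - u x = (LBINT s:{0<..}. normal_density 0 (sqrt (2 * t)) s *\<^sub>R second_difference u s x)"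
proof -
  let ?n = "normal_density 0 (sqrt (2 * t))"
  obtain C where C: "C > 0" "\<And>x. cmod (u x) \<le> C / (1 + x\<^sup>2)"
    using schwartz_increments[OF u] by metis
  have [measurable]: "u \<in> borel_measurable borel"
    by (rule borel_measurable_continuous_onI[OF schwartz_continuous[OF u]])
  have n: "integrable lborel ?n" using t by simp
  have i1: "integrable lborel (\<lambda>s. ?n s *\<^sub>R u (x + s))"
  proof (rule Bochner_Integration.integrable_bound)
    show "integrable lborel (\<lambda>s. C * ?n s)" using n by simp
    have "cmod (u y) \<le> C" for y
      using C(2)[of y] mult_left_mono[OF inverse_one_plus_square_le_1[of y], of C] C(1) by simp
    then show "AE s in lborel. norm (?n s *\<^sub>R u (x + s)) \<le> norm (C * ?n s)"
      using C(1) by (intro AE_I2) (simp add: abs_mult mult.commute[of C] mult_left_mono)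
  qed measurable
  have i2: "integrable lborel (\<lambda>s. ?n s *\<^sub>R u x)" using n by simp
  have "heat t u x - u x = (LBINT s. ?n s *\<^sub>R u (x + s)) - (LBINT s. ?n s *\<^sub>R u x)"
    using t heat_eq_convolution(1)[OF schwartz_integrable[OF u] t] by simp
  also have "\<dots> = (LBINT s. ?n s *\<^sub>R u (x + s) - ?n s *\<^sub>R u x)"
    by (rule Bochner_Integration.integral_diff[OF i1 i2, symmetric])
  also have "\<dots> = (LBINT s:{0<..}. (?n s *\<^sub>R u (x + s) - ?n s *\<^sub>R u x) + (?n (- s) *\<^sub>R u (x + - s) - ?n (- s) *\<^sub>R u x))"
    by (rule integral_symmetric_pair(2)[OF Bochner_Integration.integrable_diff[OF i1 i2]])
  also have "\<dots> = (LBINT s:{0<..}. ?n s *\<^sub>R second_difference u s x)"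
  proof -
    have "(c *\<^sub>R v - c *\<^sub>R z) + (c *\<^sub>R w - c *\<^sub>R z) = c *\<^sub>R (v + w - 2 *\<^sub>R z)" for c and v w z :: complex
      by (simp add: scaleR_2 scaleR_diff_right scaleR_add_right)
    moreover have "?n (- s) = ?n s" for s by (simp add: normal_density_def)
    ultimately show ?thesis by (simp add: second_difference_def)
  qed
  finally show ?thesis .
qed

text \<open>The inverted Gamma integral with p = s^2/4 and exponent 1/2 + b, the half coming from
  the t^(-1/2) of the density. The 2 in 4^(1/2+b) = 2 * 4^b cancels against sqrt (4 pi) = 2 sqrt
  pi.\<close>

lemma gaussian_time_integral:
  assumes "b > 0" "s > 0"
  shows "has_bochner_integral lborel
    (\<lambda>t. indicator {0<..} t * (normal_density 0 (sqrt (2 * t)) s / t powr (1 + b)))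
    (4 powr b * Gamma (1 / 2 + b) / sqrt pi / s powr (1 + 2 * b))"
proof -
  have "has_bochner_integral lborel (\<lambda>t. 1 / sqrt (4 * pi) *
      (indicator {0<..} t * (t powr (- 1 - (1 / 2 + b)) * exp (- (s\<^sup>2 / 4 / t)))))
      (1 / sqrt (4 * pi) * (Gamma (1 / 2 + b) / (s\<^sup>2 / 4) powr (1 / 2 + b)))"
    by (intro has_bochner_integral_mult_right has_bochner_integral_inverse_Gamma_scaled)
       (use assms in auto)
  moreover have "1 / sqrt (4 * pi) * (indicator {0<..} t * (t powr (- 1 - (1 / 2 + b)) * exp (- (s\<^sup>2 / 4 / t)))) =
      indicator {0<..} t * (normal_density 0 (sqrt (2 * t)) s / t powr (1 + b))" for t
  proof (cases "t > 0")
    case True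
    have "t powr (- 1 - (1 / 2 + b)) = t powr (- (1 / 2)) * t powr (- (1 + b))"
      by (simp add: powr_add[symmetric])
    also have "\<dots> = 1 / sqrt t / t powr (1 + b)"
      using True by (simp only: powr_minus_divide) (simp add: powr_half_sqrt)
    finally have "t powr (- 1 - (1 / 2 + b)) = 1 / sqrt t / t powr (1 + b)" .
    moreover have "normal_density 0 (sqrt (2 * t)) s = 1 / sqrt (4 * pi) * (1 / sqrt t) * exp (- (s\<^sup>2 / 4 / t))"
    proof -
      have "sqrt (2 * pi * (sqrt (2 * t))\<^sup>2) = sqrt (4 * pi) * sqrt t"
        unfolding real_sqrt_mult[symmetric] using True by simp
      moreover have "- (s - 0)\<^sup>2 / (2 * (sqrt (2 * t))\<^sup>2) = - (s\<^sup>2 / 4 / t)"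
        using True by simp
      ultimately show ?thesis by (simp only: normal_density_def) simp
    qed
    ultimately show ?thesis using True by (simp only: indicator_simps greaterThan_iff) simp
  qed simp
  moreover have "1 / sqrt (4 * pi) * (Gamma (1 / 2 + b) / (s\<^sup>2 / 4) powr (1 / 2 + b)) =
      4 powr b * Gamma (1 / 2 + b) / sqrt pi / s powr (1 + 2 * b)"
  proof -
    have "s\<^sup>2 powr (1 / 2 + b) = (s powr 2) powr (1 / 2 + b)"
      using assms by (simp add: powr_numeral)
    also have "\<dots> = s powr (1 + 2 * b)"
      unfolding powr_powr by (simp add: ring_distribs)
    finally have "(s\<^sup>2 / 4) powr (1 / 2 + b) = s powr (1 + 2 * b) / 4 powr (1 / 2 + b)"
      using assms by (simp add: powr_divide)
    moreover have "(4::real) powr (1 / 2 + b) = 2 * 4 powr b"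
      by (simp add: powr_add powr_half_sqrt)
    moreover have "sqrt (4 * pi) = 2 * sqrt pi" by (simp add: real_sqrt_mult)
    ultimately show ?thesis by (simp only:) simp
  qed
  ultimately show ?thesis by simp
qed

text \<open>The Gaussian weight is nonnegative, so integrating norms over time gives exactly M times
  the norm of the hypersingular integrand, already known to be integrable. With b = a/2 the power 1
  + 2b becomes 1 + a.\<close>

lemma heat_fractional_integral:
  assumes a: "0 < a" "a < 1" and u: "schwartz u"
  shows "set_integrable lborel {0<..} (\<lambda>t. (heat t u x - u x) /\<^sub>R t powr (1 + a / 2))"
    and "(LBINT t:{0<..}. (heat t u x - u x) /\<^sub>R t powr (1 + a / 2)) =
      (4 powr (a / 2) * Gamma (1 / 2 + a / 2) / sqrt pi) *\<^sub>R hypersingular a u x"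
proof -
  define M where "M = 4 powr (a / 2) * Gamma (1 / 2 + a / 2) / sqrt pi"
  have M: "M \<ge> 0" using a Gamma_real_pos[of "1 / 2 + a / 2"] by (simp add: M_def)
  have [measurable]: "u \<in> borel_measurable borel"
    by (rule borel_measurable_continuous_onI[OF schwartz_continuous[OF u]])
  let ?w = "\<lambda>s t. indicator {0<..} t * (normal_density 0 (sqrt (2 * t)) s / t powr (1 + a / 2))"
  let ?f = "\<lambda>s t. ?w s t *\<^sub>R (indicator {0<..} s *\<^sub>R second_difference u s x)"
  have time: "has_bochner_integral lborel (?w s) (M / s powr (1 + a))" if "s > 0" for s
    using gaussian_time_integral[of "a / 2" s] a that by (simp add: M_def)
  have wint: "integrable lborel (?w s)" if "s > 0" for s
    using time[OF that] by (simp add: has_bochner_integral_iff)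
  have fint: "integrable lborel (?f s)" for s
    using wint[of s] by (cases "s > 0") auto
  have w0: "?w s t \<ge> 0" for s t by (simp add: indicator_def)
  have f: "integrable (lborel \<Otimes>\<^sub>M lborel) (case_prod ?f)"
  proof (rule lborel_pair.Fubini_integrable)
    show "case_prod ?f \<in> borel_measurable (lborel \<Otimes>\<^sub>M lborel)"
      unfolding second_difference_def normal_density_def by measurable
    show "AE s in lborel. integrable lborel (\<lambda>t. case_prod ?f (s, t))"
      using fint by simp
    have "(LBINT t. norm (case_prod ?f (s, t))) =
        M * norm (indicator {0<..} s *\<^sub>R (second_difference u s x /\<^sub>R s powr (1 + a)))" for s
    proof (cases "s > 0")
      case True
      have "(LBINT t. norm (case_prod ?f (s, t))) = (LBINT t. ?w s t * norm (second_difference u s x))"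
        using w0[of _ s] True by (simp add: abs_mult)
      also have "\<dots> = (LBINT t. ?w s t) * norm (second_difference u s x)"
        by (rule integral_mult_left_zero)
      also have "(LBINT t. ?w s t) = M / s powr (1 + a)"
        using time[OF True] by (simp add: has_bochner_integral_iff)
      also have "M / s powr (1 + a) * norm (second_difference u s x) =
          M * norm (indicator {0<..} s *\<^sub>R (second_difference u s x /\<^sub>R s powr (1 + a)))"
        using True by (simp add: divide_inverse)
      finally show ?thesis .
    qed simp
    then show "integrable lborel (\<lambda>s. LBINT t. norm (case_prod ?f (s, t)))"
      using integrable_norm[OF schwartz_hypersingular_set_integrable[OF assms, of x, unfolded set_integrable_def]]
      by (simp only: integrable_mult_right)
  qed
  have fs: "(LBINT s. ?f s t) = indicator {0<..} t *\<^sub>R ((heat t u x - u x) /\<^sub>R t powr (1 + a / 2))" for t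
  proof (cases "t > 0")
    case True
    have "(LBINT s. ?f s t) = (LBINT s. inverse (t powr (1 + a / 2)) *\<^sub>R
        (indicator {0<..} s *\<^sub>R (normal_density 0 (sqrt (2 * t)) s *\<^sub>R second_difference u s x)))"
    proof (rule Bochner_Integration.integral_cong[OF refl])
      fix s
      show "?f s t = inverse (t powr (1 + a / 2)) *\<^sub>R
        (indicator {0<..} s *\<^sub>R (normal_density 0 (sqrt (2 * t)) s *\<^sub>R second_difference u s x))"
      proof -
        define q where "q = t powr (1 + a / 2)"
        show ?thesis
          unfolding q_def[symmetric] using True by (cases "s > 0") (simp_all add: divide_inverse mult.commute)
      qed
    qed
    also have "\<dots> = inverse (t powr (1 + a / 2)) *\<^sub>R (heat t u x - u x)"
      by (simp only: integral_scaleR_right heat_increment[OF u True] set_lebesgue_integral_def)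
    also have "\<dots> = indicator {0<..} t *\<^sub>R ((heat t u x - u x) /\<^sub>R t powr (1 + a / 2))"
      using True by simp
    finally show ?thesis .
  qed simp
  have ft: "(LBINT t. ?f s t) = M *\<^sub>R (indicator {0<..} s *\<^sub>R (second_difference u s x /\<^sub>R s powr (1 + a)))" for s
  proof (cases "s > 0")
    case True
    have "(LBINT t. ?f s t) = (LBINT t. ?w s t) *\<^sub>R (indicator {0<..} s *\<^sub>R second_difference u s x)"
      by (rule integral_scaleR_left) (rule wint[OF True])
    also have "(LBINT t. ?w s t) = M / s powr (1 + a)"
      using time[OF True] by (simp add: has_bochner_integral_iff)
    also have "(M / s powr (1 + a)) *\<^sub>R (indicator {0<..} s *\<^sub>R second_difference u s x) =
        M *\<^sub>R (indicator {0<..} s *\<^sub>R (second_difference u s x /\<^sub>R s powr (1 + a)))"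
      using True by (simp add: divide_inverse)
    finally show ?thesis .
  qed simp
  show "set_integrable lborel {0<..} (\<lambda>t. (heat t u x - u x) /\<^sub>R t powr (1 + a / 2))"
    using lborel_pair.integrable_snd[OF f] unfolding fs set_integrable_def .
  have "(LBINT t:{0<..}. (heat t u x - u x) /\<^sub>R t powr (1 + a / 2)) = (LBINT t. LBINT s. ?f s t)"
    unfolding fs set_lebesgue_integral_def ..
  also have "\<dots> = (LBINT s. LBINT t. ?f s t)"
    by (rule lborel_pair.Fubini_integral[OF f])
  also have "\<dots> = M *\<^sub>R hypersingular a u x"
    unfolding ft hypersingular_def set_lebesgue_integral_def by (rule integral_scaleR_right)
  finally show "(LBINT t:{0<..}. (heat t u x - u x) /\<^sub>R t powr (1 + a / 2)) =
      (4 powr (a / 2) * Gamma (1 / 2 + a / 2) / sqrt pi) *\<^sub>R hypersingular a u x"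
    by (simp only: M_def)
qed


section \<open>Gamma identities that match the constants\<close>

lemma Gamma_reflection_real:
  fixes x :: real
  shows "Gamma x * Gamma (1 - x) = pi / sin (pi * x)"
proof -
  have "complex_of_real (Gamma x * Gamma (1 - x)) = of_real (pi / sin (pi * x))"
    using Gamma_reflection_complex[of "of_real x"]
    by (simp add: Gamma_complex_of_real[symmetric] sin_of_real[symmetric])
  then show ?thesis by (simp only: of_real_eq_iff)
qed

text \<open>Reflection at 1 + x rather than at x: then 1 - (1 + x) = -x, and the sine changes
  sign.\<close>

lemma inverse_Gamma_minus:
  fixes x :: real
  assumes "0 < x" "x < 1"
  shows "1 / Gamma (- x) = - (Gamma (1 + x) * sin (pi * x) / pi)"
proof -
  have s: "sin (pi * x) > 0"
    using assms by (intro sin_gt_zero) auto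
  have "Gamma (1 + x) * Gamma (1 - (1 + x)) = pi / sin (pi * (1 + x))"
    by (rule Gamma_reflection_real)
  then have "Gamma (1 + x) * Gamma (- x) = - (pi / sin (pi * x))"
    by (simp add: ring_distribs sin_add)
  moreover have "Gamma (1 + x) > 0" using assms by (intro Gamma_real_pos) auto
  moreover from calculation s have "Gamma (- x) \<noteq> 0" by auto
  ultimately show ?thesis using s by (simp add: field_simps)
qed

text \<open>Legendre duplication at 1/2 + x, whose partner is 1 + x; the factor 4^x absorbs the
  2^(-2x) on its right side.\<close>

lemma Gamma_duplication_shifted:
  fixes x :: real
  assumes "x > 0"
  shows "4 powr x * Gamma (1 / 2 + x) * Gamma (1 + x) = sqrt pi * Gamma (1 + 2 * x)"
proof -
  have "complex_of_real (1 / 2 + x) \<notin> \<int>\<^sub>\<le>\<^sub>0" "complex_of_real (1 / 2 + x) + 1 / 2 \<notin> \<int>\<^sub>\<le>\<^sub>0"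
    using assms by (auto elim!: nonpos_Ints_cases simp: complex_eq_iff)
  from Gamma_legendre_duplication[OF this]
  have "complex_of_real (Gamma (1 / 2 + x) * Gamma (1 + x)) =
      of_real (exp (- (2 * x * ln 2)) * sqrt pi * Gamma (1 + 2 * x))"
    by (simp add: Gamma_complex_of_real[symmetric] exp_of_real[symmetric] algebra_simps)
  then have "Gamma (1 / 2 + x) * Gamma (1 + x) = exp (- (2 * x * ln 2)) * sqrt pi * Gamma (1 + 2 * x)"
    by (simp only: of_real_eq_iff)
  moreover have "4 powr x * exp (- (2 * x * ln 2)) = 1"
  proof -
    have "ln (4::real) = 2 * ln 2" using ln_realpow[of 2 2] by simp
    then show ?thesis by (simp add: powr_def mult_ac flip: exp_add)
  qed
  ultimately show ?thesis by (simp add: mult.assoc)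
qed

text \<open>Reflection at a/2 supplies Gamma(1 + a/2), the partner that duplication needs for
  Gamma(1/2 + a/2).\<close>

lemma frac_laplacian_constant:
  fixes a :: real
  assumes "0 < a" "a < 1"
  shows "1 / Gamma (- (a / 2)) * (4 powr (a / 2) * Gamma (1 / 2 + a / 2) / sqrt pi) =
    - (1 / pi) * Gamma (1 + a) * sin (pi * a / 2)"
proof -
  have "1 / Gamma (- (a / 2)) * (4 powr (a / 2) * Gamma (1 / 2 + a / 2) / sqrt pi) =
      - ((4 powr (a / 2) * Gamma (1 / 2 + a / 2) * Gamma (1 + a / 2)) * (sin (pi * (a / 2)) / pi / sqrt pi))"
    using inverse_Gamma_minus[of "a / 2"] assms by simp
  also have "\<dots> = - ((sqrt pi * Gamma (1 + a)) * (sin (pi * (a / 2)) / pi / sqrt pi))"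
    using Gamma_duplication_shifted[of "a / 2"] assms by simp
  also have "\<dots> = - (1 / pi) * Gamma (1 + a) * sin (pi * a / 2)"
    by (simp add: field_simps)
  finally show ?thesis .
qed

lemma sin_double_half: "sin (pi * a) = 2 * sin (pi * a / 2) * cos (pi * a / 2)"
  using sin_double[of "pi * a / 2"] by simp

lemma D_difference_constant:
  fixes a :: real
  assumes "0 < a" "a < 1"
  shows "- (1 / (2 * sin (pi * a / 2))) * (1 / Gamma (- a)) = 1 / pi * Gamma (1 + a) * cos (pi * a / 2)"
proof -
  have "sin (pi * a / 2) > 0" using assms by (intro sin_gt_zero) auto
  then show ?thesis
    unfolding inverse_Gamma_minus[OF assms] sin_double_half by (simp add: field_simps)
qed

lemma hilbert_constant:
  fixes a :: real
  assumes "0 < a" "a < 1"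
  shows "1 / pi * ((- (1 / pi) * Gamma (1 + a) * sin (pi * a / 2)) *
      (- (Gamma a * Gamma (1 - a)) * (1 + cos (pi * a)))) = 1 / pi * Gamma (1 + a) * cos (pi * a / 2)"
proof -
  have s: "sin (pi * a / 2) > 0" using assms by (intro sin_gt_zero) auto
  have c: "cos (pi * a / 2) > 0" using assms by (intro cos_gt_zero) auto
  have "1 + cos (pi * a) = 2 * (cos (pi * a / 2))\<^sup>2"
    using cos_double_cos[of "pi * a / 2"] by simp
  then show ?thesis
    unfolding Gamma_reflection_real sin_double_half using s c
    by (simp add: power2_eq_square field_simps)
qed

section \<open>Convergence of all integrals and the three identities\<close>

theorem proposition5p3:
  fixes \<alpha> :: real and u :: "real \<Rightarrow> complex"
  assumes "0 < \<alpha>" and "\<alpha> < 1" and "schwartz u"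
  shows
    "(\<forall>x. k_minus_converges \<alpha> u x \<and> H_minus_converges \<alpha> u x \<and>
          D_right_converges \<alpha> u x \<and> D_left_converges \<alpha> u x \<and>
          frac_laplacian_converges (\<alpha> / 2) u x \<and>
          hilbert_converges (frac_laplacian (\<alpha> / 2) u) x) \<and>
     (\<forall>x. k_minus \<alpha> u x = frac_laplacian (\<alpha> / 2) u x) \<and>
     (\<forall>x. H_minus \<alpha> u x =
          (- (1 / (2 * sin (pi * \<alpha> / 2)))) *\<^sub>R (D_right \<alpha> u x - D_left \<alpha> u x)) \<and>
     (\<forall>x. H_minus \<alpha> u x = hilbert (frac_laplacian (\<alpha> / 2) u) x)"
proof -
  note a = assms(1,2) and u = assms(3)
  have [measurable]: "u \<in> borel_measurable borel"
    by (rule borel_measurable_continuous_onI[OF schwartz_continuous[OF u]])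
  obtain C where C: "C > 0"
    "\<And>x s. cmod (u (x + s) - u x) \<le> C * min 1 \<bar>s\<bar> * (1 / (1 + x\<^sup>2) + 1 / (1 + (x + s)\<^sup>2))"
    using schwartz_increments[OF u] by metis
  note inc = schwartz_increment_uniform_bound[OF C]
  have Dr: "D_right_converges \<alpha> u x" for x
    unfolding D_right_converges_def
  proof (rule weighted_set_integrable[OF a])
    show "norm (u (x + s) - u x) \<le> 2 * C * min 1 s" if "s > 0" for s
      using inc[of x s] that by simp
  qed measurable
  have Dl: "D_left_converges \<alpha> u x" for x
    unfolding D_left_converges_def
  proof (rule weighted_set_integrable[OF a])
    show "norm (u (x - s) - u x) \<le> 2 * C * min 1 s" if "s > 0" for s
      using inc[of x "- s"] that by simp
  qed measurable
  have diff: "(u (x + t) - u (x - t)) /\<^sub>R t powr (1 + \<alpha>) =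
      (u (x + t) - u x) /\<^sub>R t powr (1 + \<alpha>) - (u (x - t) - u x) /\<^sub>R t powr (1 + \<alpha>)" for x t
    by (simp add: scaleR_diff_right)
  have Hc: "H_minus_converges \<alpha> u x" for x
    unfolding H_minus_converges_def diff
    by (rule set_integral_diff(1)) (use Dr[of x] Dl[of x] in \<open>simp_all add: D_right_converges_def D_left_converges_def\<close>)
  have HD: "H_minus \<alpha> u x = (- (1 / (2 * sin (pi * \<alpha> / 2)))) *\<^sub>R (D_right \<alpha> u x - D_left \<alpha> u x)" for x
  proof -
    have "(LBINT t:{0<..}. (u (x + t) - u (x - t)) /\<^sub>R t powr (1 + \<alpha>)) =
      (LBINT t:{0<..}. (u (x + t) - u x) /\<^sub>R t powr (1 + \<alpha>)) - (LBINT t:{0<..}. (u (x - t) - u x) /\<^sub>R t powr (1 + \<alpha>))"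
      unfolding diff
      by (rule set_integral_diff(2)) (use Dr[of x] Dl[of x] in \<open>simp_all add: D_right_converges_def D_left_converges_def\<close>)
    then show ?thesis
      unfolding H_minus_def D_right_def D_left_def scaleR_diff_right[symmetric] scaleR_scaleR
        D_difference_constant[OF a] by (simp only:)
  qed
  let ?g = "\<lambda>x t. (u t - u x) /\<^sub>R \<bar>t - x\<bar> powr (1 + \<alpha>)"
  \<comment> \<open>Since alpha < 1, the integrand of the principal value is integrable on the whole
    line, with the weight reflected to both sides of x as majorant. The truncations therefore
    converge, and folding produces the second difference.\<close>
  have gint: "integrable lborel (?g x)" for x
  proof (rule Bochner_Integration.integrable_bound)
    note tw = integrable_truncated_weight[OF a]
    show "integrable lborel (\<lambda>t. 2 * C * (truncated_weight \<alpha> (t - x) + truncated_weight \<alpha> (- (t - x))))"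
      using integrable_translation(2)[OF tw, of x] integrable_translation(2)[OF integrable_reflect[OF tw], of x]
      by (intro integrable_mult_right Bochner_Integration.integrable_add)
    show "AE t in lborel. norm (?g x t) \<le>
        norm (2 * C * (truncated_weight \<alpha> (t - x) + truncated_weight \<alpha> (- (t - x))))"
    proof (rule AE_I2)
      fix t
      have i: "cmod (u t - u x) \<le> 2 * C * min 1 \<bar>t - x\<bar>" using inc[of x "t - x"] by simp
      have "norm (?g x t) \<le> 2 * C * (truncated_weight \<alpha> (t - x) + truncated_weight \<alpha> (- (t - x)))"
      proof (cases "t = x")
        case True
        then show ?thesis by (simp add: truncated_weight_def)
      next
        case False
        have "norm (indicator {0<..} \<bar>t - x\<bar> *\<^sub>R ?g x t) \<le> 2 * C * truncated_weight \<alpha> \<bar>t - x\<bar>"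
          by (rule weighted_bound) (rule i)
        also have "truncated_weight \<alpha> \<bar>t - x\<bar> = truncated_weight \<alpha> (t - x) + truncated_weight \<alpha> (- (t - x))"
          by (cases "t < x") (auto simp: truncated_weight_def)
        finally show ?thesis using False by simp
      qed
      then show "norm (?g x t) \<le> norm (2 * C * (truncated_weight \<alpha> (t - x) + truncated_weight \<alpha> (- (t - x))))"
        by (rule order_trans) simp
    qed
  qed measurable
  have gset: "set_integrable lborel {t. \<bar>t - x\<bar> > e} (?g x)" for x e
    unfolding set_integrable_def by (rule integrable_mult_indicator) (use gint in auto)
  \<comment> \<open>The indicator restricts the identity to t > 0, where |t| and |-t| are both
    t.\<close>
  have gpair: "indicator {0<..} t *\<^sub>R (?g x (x + t) + ?g x (x - t)) =
      indicator {0<..} t *\<^sub>R (second_difference u t x /\<^sub>R t powr (1 + \<alpha>))" for x t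
    by (cases "t > 0") (simp_all add: second_difference_def scaleR_2 algebra_simps)
  have gpi: "set_integrable lborel {0<..} (\<lambda>t. ?g x (x + t) + ?g x (x - t))" for x
    using schwartz_hypersingular_set_integrable[OF assms, of x] unfolding set_integrable_def gpair .
  have kc: "k_minus_converges \<alpha> u x" for x
    unfolding k_minus_converges_def by (rule pv_symmetric_pair(1)[OF gset gpi])
  have k: "k_minus \<alpha> u x = (- (1 / pi) * Gamma (1 + \<alpha>) * sin (pi * \<alpha> / 2)) *\<^sub>R hypersingular \<alpha> u x" for x
    using pv_symmetric_pair(2)[OF gset gpi, of x]
    unfolding k_minus_def hypersingular_def set_lebesgue_integral_def gpair by (simp only:)
  have fl: "frac_laplacian (\<alpha> / 2) u x =
      (- (1 / pi) * Gamma (1 + \<alpha>) * sin (pi * \<alpha> / 2)) *\<^sub>R hypersingular \<alpha> u x" for x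
    unfolding frac_laplacian_def heat_fractional_integral(2)[OF assms] scaleR_scaleR
      frac_laplacian_constant[OF a] ..
  have flc: "frac_laplacian_converges (\<alpha> / 2) u x" for x
    unfolding frac_laplacian_converges_def heat_converges_def
    using schwartz_integrable[OF u] heat_eq_convolution(2)[OF schwartz_integrable[OF u]]
      heat_fractional_integral(1)[OF assms] by blast
  let ?c = "- (1 / pi) * Gamma (1 + \<alpha>) * sin (pi * \<alpha> / 2)"
  note h = hilbert_hypersingular[OF assms]
  have hk: "frac_laplacian (\<alpha> / 2) u t /\<^sub>R (t - x) = ?c *\<^sub>R (hypersingular \<alpha> u t /\<^sub>R (t - x))" for t x
    unfolding fl by (rule scaleR_left_commute)
  \<comment> \<open>\<open>pv_integral\<close> is a \<open>Lim\<close>, meaningful only once a limit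
    exists; actual convergence is recovered here so that the constant can be pulled out of the
    limit.\<close>
  have lim: "((\<lambda>e. LBINT t:{t. \<bar>t - x\<bar> > e}. hypersingular \<alpha> u t /\<^sub>R (t - x)) \<longlongrightarrow>
      pv_integral x (\<lambda>t. hypersingular \<alpha> u t /\<^sub>R (t - x))) (at_right 0)" for x
  proof -
    obtain L where L: "((\<lambda>e. LBINT t:{t. \<bar>t - x\<bar> > e}. hypersingular \<alpha> u t /\<^sub>R (t - x)) \<longlongrightarrow> L) (at_right 0)"
      using h(1)[of x] unfolding pv_converges_def by blast
    then show ?thesis unfolding pv_integral_def using tendsto_Lim[OF _ L] by simp
  qed
  have lim': "((\<lambda>e. LBINT t:{t. \<bar>t - x\<bar> > e}. frac_laplacian (\<alpha> / 2) u t /\<^sub>R (t - x)) \<longlongrightarrow>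
      ?c *\<^sub>R pv_integral x (\<lambda>t. hypersingular \<alpha> u t /\<^sub>R (t - x))) (at_right 0)" for x
    unfolding hk set_integral_scaleR_right by (intro tendsto_scaleR tendsto_const lim)
  have hc: "hilbert_converges (frac_laplacian (\<alpha> / 2) u) x" for x
    unfolding hilbert_converges_def pv_converges_def
  proof (intro conjI allI impI exI)
    show "set_integrable lborel {t. \<epsilon> < \<bar>t - x\<bar>} (\<lambda>t. frac_laplacian (\<alpha> / 2) u t /\<^sub>R (t - x))" if "\<epsilon> > 0" for \<epsilon>
      unfolding hk using h(1)[of x] that by (intro set_integrable_scaleR_right) (simp add: pv_converges_def)
  qed (rule lim')
  have hH: "H_minus \<alpha> u x = hilbert (frac_laplacian (\<alpha> / 2) u) x" for x
  proof -
    have "pv_integral x (\<lambda>t. frac_laplacian (\<alpha> / 2) u t /\<^sub>R (t - x)) =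
        ?c *\<^sub>R pv_integral x (\<lambda>t. hypersingular \<alpha> u t /\<^sub>R (t - x))"
      unfolding pv_integral_def[of x "\<lambda>t. frac_laplacian (\<alpha> / 2) u t /\<^sub>R (t - x)"]
      by (rule tendsto_Lim[OF _ lim']) simp
    then have "hilbert (frac_laplacian (\<alpha> / 2) u) x = (1 / pi * (?c * (- (Gamma \<alpha> * Gamma (1 - \<alpha>)) * (1 + cos (pi * \<alpha>))))) *\<^sub>R
        (LBINT t:{0<..}. (u (x + t) - u (x - t)) /\<^sub>R t powr (1 + \<alpha>))"
      unfolding hilbert_def h(2) scaleR_scaleR by (simp only: scaleR_scaleR)
    then show ?thesis unfolding hilbert_constant[OF a] H_minus_def by (simp only:)
  qed
  show ?thesis using kc Hc Dr Dl flc hc k fl HD hH by simp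
qed

end
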